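(* Let $\Gamma = \{ g_1 = 1, g_2, \ldots, g_n \}$ be a finite abelian group of order $n$, let $R$ be a polynomial ring over $\mathbb{C}$ containing the variables $x_g$ ($g \in \Gamma$), let $K_\Gamma$ be the complete graph with $n$ loops on the vertex set $\Gamma$, and let its weighted matrix be the group matrix, $\mathbf{W}(K_\Gamma) = \mathbf{M}(\Gamma) = (x_{g_i^{-1} g_j})_{1 \le i,j \le n}$, i.e. $w(g,h) = x_{g^{-1}h}$ for $g,h \in \Gamma$. Suppose that $x_g = x_{g^{-1}}$ for all $g \in \Gamma$ with $g \neq 1$, and that $x_1 = 0$. Then the weighted complexity of $K_\Gamma$ is $$ \kappa_w(K_\Gamma) = \frac{1}{n} \prod_{\chi \neq 1} \ \sum_{g \in \Gamma,\, g \neq 1} (1 - \chi(g))\, x_g, $$ where $\chi$ runs over all nontrivial (complex, one-dimensional) characters of $\Gamma$.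
   Context: The graph $K_\Gamma$ has vertex set $\Gamma$, exactly one edge joining each pair of distinct vertices, and one loop at each vertex. The variables $x_g$ are independent apart from the imposed relations $x_g = x_{g^{-1}}$ and $x_1 = 0$. Weighted complexity: let $G$ be a connected graph with a symmetric arc weight $w$ (i.e. $w(e^{-1}) = w(e)$ for every arc $e$). A spanning arborescence $T_v$ of $G$ rooted at a vertex $v$ is a spanning subdigraph of the symmetric digraph of $G$ (in which each edge is replaced by two opposite arcs) whose underlying graph is a spanning tree of $G$ and in which every vertex $x \neq v$ has outdegree $1$ (so all arcs are directed towards $v$). Put $w(T_v) = \prod_{e \in D(T_v)} w(e)$, the product over the arcs of $T_v$. The weighted complexity is $\kappa_w(G) = \sum_{T_v} w(T_v)$, the sum over all spanning arborescences rooted at a fixed vertex $v$; it does not depend on the choice of $v$. *)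

theory Defs
  imports
    Complex_Main
    "HOL-Library.Poly_Mapping"
    "HOL-Algebra.Coset"
    "Graph_Theory.Digraph_Component"
begin

text \<open>
  Polynomials over the complex numbers in (possibly infinitely many) variables indexed by the
  elements of the type 'v: finitely supported maps from monomials to coefficients.
\<close>

type_synonym 'v cpoly = "('v \<Rightarrow>\<^sub>0 nat) \<Rightarrow>\<^sub>0 complex"

definition cpoly_const :: "complex \<Rightarrow> 'v cpoly" where
  "cpoly_const c = Poly_Mapping.single 0 c"

definition cpoly_var :: "'v \<Rightarrow> 'v cpoly" where
  "cpoly_var i = Poly_Mapping.single (Poly_Mapping.single i 1) 1"


text \<open>
  A graph without parallel edges is a pair of a vertex set and a set of edges, where an edge
  is the set of its ends; a loop is a singleton.
\<close>

type_synonym 'a loop_graph = "'a set \<times> 'a set set"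

text \<open>
  The arcs are the ordered pairs of adjacent vertices, so the two orientations of a loop coincide.
\<close>

definition symmetric_digraph :: "'a loop_graph \<Rightarrow> ('a, 'a \<times> 'a) pre_digraph" where
  "symmetric_digraph H =
    \<lparr> verts = fst H, arcs = {(u, v). {u, v} \<in> snd H}, tail = fst, head = snd \<rparr>"

text \<open>
  A cycle of the underlying undirected multigraph (one edge for each arc), with vertices us and
  edges es, both without repetition. Length 1 is a loop; length 2 is a pair of parallel or
  opposite arcs.
\<close>

definition underlying_cycle :: "('a, 'b) pre_digraph \<Rightarrow> 'a list \<Rightarrow> 'b list \<Rightarrow> bool" where
  "underlying_cycle T us es \<longleftrightarrow>
     us \<noteq> [] \<and> length es = length us \<and> distinct us \<and> distinct es \<and> set es \<subseteq> arcs T \<and>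
     (\<forall>i < length us.
        {tail T (es ! i), head T (es ! i)} = {us ! i, us ! (Suc i mod length us)})"

text \<open>
  The constant \<^const>\<open>Digraph_Component.connected\<close> is connectedness of the underlying graph, but
  \<^const>\<open>Digraph_Component.forest\<close> only excludes directed cycles, which is not what is needed here.
\<close>

definition underlying_tree :: "('a, 'b) pre_digraph \<Rightarrow> bool" where
  "underlying_tree T \<longleftrightarrow>
     Digraph_Component.connected T \<and> \<not> (\<exists>us es. underlying_cycle T us es)"

text \<open>
  A tree has one edge less than it has vertices, so the root has outdegree 0.
\<close>

definition spanning_arborescence ::
    "('a, 'b) pre_digraph \<Rightarrow> 'a \<Rightarrow> ('a, 'b) pre_digraph \<Rightarrow> bool" where
  "spanning_arborescence D v T \<longleftrightarrow>
     spanning T D \<and> underlying_tree T \<and> v \<in> verts T \<and>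
     (\<forall>x \<in> verts T - {v}. out_degree T x = 1)"

definition weighted_complexity ::
    "'a loop_graph \<Rightarrow> ('a \<times> 'a \<Rightarrow> 'r::comm_ring_1) \<Rightarrow> 'a \<Rightarrow> 'r" where
  "weighted_complexity H w v =
     (\<Sum>T | spanning_arborescence (symmetric_digraph H) v T. \<Prod>e\<in>arcs T. w e)"


definition complete_loop_graph :: "('a, 'm) monoid_scheme \<Rightarrow> 'a loop_graph" where
  "complete_loop_graph G = (carrier G, {{g, h} | g h. g \<in> carrier G \<and> h \<in> carrier G})"

definition group_matrix :: "('a, 'm) monoid_scheme \<Rightarrow> ('a \<Rightarrow> 'r) \<Rightarrow> 'a \<times> 'a \<Rightarrow> 'r" where
  "group_matrix G x = (\<lambda>(g, h). x (inv\<^bsub>G\<^esub> g \<otimes>\<^bsub>G\<^esub> h))"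


definition complex_units :: "complex monoid" where
  "complex_units = \<lparr> carrier = UNIV - {0}, monoid.mult = (*), one = 1 \<rparr>"

text \<open>Extensionality makes the representation of a character unique.\<close>

definition characters :: "('a, 'm) monoid_scheme \<Rightarrow> ('a \<Rightarrow> complex) set" where
  "characters G = hom G complex_units \<inter> extensional (carrier G)"

definition trivial_character :: "('a, 'm) monoid_scheme \<Rightarrow> 'a \<Rightarrow> complex" where
  "trivial_character G = (\<lambda>g\<in>carrier G. 1)"

end

theory Submission
  imports
    "Jordan_Normal_Form.Determinant"
    "HOL-Algebra.Multiplicative_Group"
    Defs
begin

text \<open>
  Let \<open>n\<close> be the order of the group, \<open>L\<close> the Laplacian of the weighted complete graph and \<open>J\<close> the
  all-ones matrix. The proof computes \<open>det (L + J)\<close> in two ways.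

  On the combinatorial side, the matrix-tree theorem (\<open>weighted_matrix_tree\<close>) says that the weighted
  complexity \<open>\<kappa>\<close> at the root \<open>v\<close> is the principal minor of \<open>L\<close> at \<open>v\<close>. Expanding this minor in all
  its rows at once gives a sum over all maps \<open>f\<close> that choose one outgoing arc \<open>(x, f x)\<close> at each vertex
  \<open>x \<noteq> v\<close>. The determinant that belongs to \<open>f\<close> is \<open>1\<close> if all iterated paths lead to \<open>v\<close> and \<open>0\<close>
  otherwise (\<open>det_on_parent_matrix\<close>), and the maps of the first kind correspond to the spanning
  arborescences. All rows and all columns of a group matrix have the same sum, so \<open>L\<close> has zero row and
  column sums, and \<open>det (L + J) = n\<^sup>2 \<kappa>\<close> (\<open>det_laplacian_plus_ones\<close>).

  On the algebraic side, every character \<open>\<chi>\<close> is an eigenvector of \<open>L + J\<close>: the eigenvalue is \<open>n\<close> for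
  the trivial character and \<open>\<Sum>g\<noteq>\<one>. (1 - \<chi> g) x\<^sub>g\<close> for the others
  (\<open>laplacian_character_eigenvector\<close>). There are \<open>n\<close> characters (\<open>card_characters\<close>), because
  characters of subgroups extend and so separate the elements of the group, and they are orthogonal.
  Hence they diagonalise \<open>L + J\<close>, and \<open>det (L + J)\<close> is \<open>n\<close> times the product of the eigenvalues of the
  nontrivial characters (\<open>det_laplacian_plus_ones_characters\<close>). Comparing the two values gives the
  formula.
\<close>

section \<open>Determinants indexed by finite sets\<close>

text \<open>
  Vertices and characters have no natural numbering, so determinants are indexed by an arbitrary
  finite set. The Leibniz formula serves as definition because the expansion over maps below is
  read off from it; the product rule comes from the determinants of numbered matrices.
\<close>

definition det_on :: "'a set \<Rightarrow> ('a \<Rightarrow> 'a \<Rightarrow> 'r::comm_ring_1) \<Rightarrow> 'r" where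
  "det_on V A = (\<Sum>p | p permutes V. of_int (sign p) * (\<Prod>x\<in>V. A x (p x)))"

lemma det_on_cong:
  assumes "\<And>x y. x \<in> V \<Longrightarrow> y \<in> V \<Longrightarrow> A x y = B x y"
  shows "det_on V A = det_on V B"
  unfolding det_on_def
  by (intro sum.cong refl arg_cong2[where f = "(*)"] prod.cong assms)
    (auto simp: permutes_in_image)

text \<open>
  Conjugation with an enumeration of the index set is a bijection between the permutations of the
  two index sets, and it preserves signs.
\<close>

lemma det_on_eq_det:
  assumes e: "bij_betw e {0..<n} V"
  shows "det_on V A = det (mat n n (\<lambda>(i, j). A (e i) (e j)))"
proof -
  let ?N = "{0..<n}"
  have inj: "inj_on e ?N" and img: "e ` ?N = V"
    using e by (auto simp: bij_betw_def)
  have conj: "map_permutation ?N e p = (\<lambda>x. if x \<in> V then e (p (inv_into ?N e x)) else x)" for p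
    by (auto simp: map_permutation_def restrict_id_def img)
  have "det_on V A = (\<Sum>p | p permutes ?N. of_int (sign (map_permutation ?N e p)) *
      (\<Prod>x\<in>V. A x (map_permutation ?N e p x)))"
    unfolding det_on_def conj
    by (rule sum.reindex_bij_betw[OF bij_betw_permutations[OF e], symmetric])
  also have "\<dots> = (\<Sum>p | p permutes ?N. of_int (sign p) * (\<Prod>i\<in>?N. A (e i) (e (p i))))"
  proof (intro sum.cong refl arg_cong2[where f = "(*)"])
    fix p assume p: "p \<in> {p. p permutes ?N}"
    show "of_int (sign (map_permutation ?N e p)) = (of_int (sign p) :: 'b)"
      using sign_map_permutation[OF inj] p by simp
    have "(\<Prod>x\<in>V. A x (map_permutation ?N e p x)) =
        (\<Prod>i\<in>?N. A (e i) (map_permutation ?N e p (e i)))"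
      by (rule prod.reindex_bij_betw[OF e, symmetric])
    also have "\<dots> = (\<Prod>i\<in>?N. A (e i) (e (p i)))"
      using inj img by (intro prod.cong) (auto simp: conj)
    finally show "(\<Prod>x\<in>V. A x (map_permutation ?N e p x)) = (\<Prod>i\<in>?N. A (e i) (e (p i)))" .
  qed
  also have "\<dots> = det (mat n n (\<lambda>(i, j). A (e i) (e j)))"
    by (subst det_def'[of _ n]) (auto intro!: sum.cong prod.cong simp: permutes_in_image)
  finally show ?thesis .
qed

lemma det_on_mult:
  assumes "finite V"
  shows "det_on V (\<lambda>x y. \<Sum>z\<in>V. A x z * B z y) = det_on V A * det_on V B"
proof -
  obtain e where e: "bij_betw e {0..<card V} V"
    using ex_bij_betw_nat_finite[OF assms] by blast
  have "mat (card V) (card V) (\<lambda>(i, j). \<Sum>z\<in>V. A (e i) z * B z (e j)) =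
      mat (card V) (card V) (\<lambda>(i, j). A (e i) (e j)) * mat (card V) (card V) (\<lambda>(i, j). B (e i) (e j))"
    by (rule eq_matI) (auto simp: scalar_prod_def sum.reindex_bij_betw[OF e, symmetric])
  then show ?thesis
    by (simp add: det_on_eq_det[OF e] det_mult[of _ "card V"])
qed

text \<open>
  This covers triangular matrices without mentioning an order on the indices: all that is used of
  triangularity is that every permutation other than the identity meets a zero entry.
\<close>

lemma det_on_eq_diagonal_product:
  assumes fin: "finite V"
    and only_id: "\<And>p. p permutes V \<Longrightarrow> p \<noteq> id \<Longrightarrow> \<exists>x\<in>V. A x (p x) = 0"
  shows "det_on V A = (\<Prod>x\<in>V. A x x)"
proof -
  have "det_on V A = (\<Sum>p\<in>{id}. of_int (sign p) * (\<Prod>x\<in>V. A x (p x)))"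
    unfolding det_on_def
  proof (rule sum.mono_neutral_right)
    show "finite {p. p permutes V}" by (rule finite_permutations[OF fin])
    show "\<forall>p\<in>{p. p permutes V} - {id}. of_int (sign p) * (\<Prod>x\<in>V. A x (p x)) = 0"
    proof
      fix p assume "p \<in> {p. p permutes V} - {id}"
      then have "\<exists>x\<in>V. A x (p x) = 0" using only_id by auto
      then have "(\<Prod>x\<in>V. A x (p x)) = 0" by (rule prod_zero[OF fin])
      then show "of_int (sign p) * (\<Prod>x\<in>V. A x (p x)) = 0" by simp
    qed
  qed (auto simp: permutes_id)
  then show ?thesis by simp
qed

lemma det_on_diagonal:
  assumes "finite V"
  shows "det_on V (\<lambda>x y. if x = y then d x else 0) = (\<Prod>x\<in>V. d x)"
proof -
  have "\<exists>x\<in>V. (if x = p x then d x else 0) = 0" if p: "p permutes V" "p \<noteq> id" for p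
  proof -
    obtain x where "p x \<noteq> x" using p(2) by fastforce
    then show ?thesis using permutes_not_in[OF p(1)] by (metis)
  qed
  from det_on_eq_diagonal_product[OF assms this] show ?thesis by simp
qed

lemma det_on_transpose:
  assumes "finite V"
  shows "det_on V (\<lambda>x y. A y x) = det_on V A"
proof -
  obtain e where e: "bij_betw e {0..<card V} V"
    using ex_bij_betw_nat_finite[OF assms] by blast
  have "mat (card V) (card V) (\<lambda>(i, j). A (e j) (e i)) =
      transpose_mat (mat (card V) (card V) (\<lambda>(i, j). A (e i) (e j)))"
    by (rule eq_matI) auto
  then show ?thesis
    by (simp add: det_on_eq_det[OF e] det_transpose[of _ "card V"])
qed

text \<open>
  If a permutation meets no zero entry here, then it sends each index to itself or to \<open>v\<close>; being
  injective and fixing \<open>v\<close>, it is the identity.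
\<close>

lemma det_on_diagonal_and_column:
  assumes fin: "finite V" and v: "v \<in> V"
    and zero: "\<And>x y. x \<in> V \<Longrightarrow> y \<in> V \<Longrightarrow> y \<noteq> x \<Longrightarrow> y \<noteq> v \<Longrightarrow> A x y = 0"
  shows "det_on V A = (\<Prod>x\<in>V. A x x)"
proof (rule det_on_eq_diagonal_product[OF fin])
  fix p assume p: "p permutes V" "p \<noteq> id"
  show "\<exists>x\<in>V. A x (p x) = 0"
  proof (rule ccontr)
    assume "\<not> ?thesis"
    then have *: "p x = x \<or> p x = v" if "x \<in> V" for x
      using zero[OF that] that p(1) by (metis permutes_in_image)
    have "p v = v" using * v by blast
    then have "p x = x" for x
      using * permutes_not_in[OF p(1)] permutes_inj[OF p(1)] by (metis injD)
    then show False using p(2) by auto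
  qed
qed

text \<open>
  Over a ring that may have zero divisors, a nonzero kernel vector does not make a determinant
  vanish, but a kernel vector with an entry \<open>1\<close> does. Put the vector in place of column \<open>c\<close> of the
  identity matrix: this matrix has determinant \<open>1\<close>, and multiplying by it turns column \<open>c\<close> of \<open>A\<close>
  into zero.
\<close>

lemma det_on_eq_0_if_kernel:
  assumes fin: "finite V" and c: "c \<in> V" "u c = 1"
    and kernel: "\<And>x. x \<in> V \<Longrightarrow> (\<Sum>y\<in>V. A x y * u y) = 0"
  shows "det_on V A = 0"
proof -
  let ?U = "\<lambda>x y. if y = c then u x else if x = y then 1 else 0"
  have "det_on V ?U = (\<Prod>x\<in>V. ?U x x)"
    by (rule det_on_diagonal_and_column[OF fin c(1)]) auto
  also have "\<dots> = 1" by (rule prod.neutral) (simp add: c(2))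
  finally have U: "det_on V ?U = 1" .
  have col: "(\<Sum>z\<in>V. A x z * ?U z c) = 0" if "x \<in> V" for x
    using kernel[OF that] by simp
  have "det_on V (\<lambda>x y. \<Sum>z\<in>V. A x z * ?U z y) = 0"
    unfolding det_on_def
  proof (rule sum.neutral, safe)
    fix p assume p: "p permutes V"
    then obtain x where x: "x \<in> V" "p x = c"
      using permutes_image[OF p] c(1) by (metis imageE)
    have "(\<Prod>x\<in>V. \<Sum>z\<in>V. A x z * ?U z (p x)) = 0"
      by (rule prod_zero[OF fin], rule bexI[OF _ x(1)]) (simp only: x(2) col[OF x(1)])
    then show "of_int (sign p) * (\<Prod>x\<in>V. \<Sum>z\<in>V. A x z * ?U z (p x)) = 0"
      by simp
  qed
  then show ?thesis
    unfolding det_on_mult[OF fin] U by simp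
qed

text \<open>
  Multilinearity in all rows at once: if each row is a linear combination of given vectors, the
  determinant is a sum over all ways of choosing one vector per row.
\<close>

lemma det_on_row_expansion:
  assumes fin: "finite V" and finS: "\<And>x. x \<in> V \<Longrightarrow> finite (S x)"
  shows "det_on V (\<lambda>x y. \<Sum>z\<in>S x. c x z * r x z y) =
    (\<Sum>f\<in>Pi\<^sub>E V S. (\<Prod>x\<in>V. c x (f x)) * det_on V (\<lambda>x. r x (f x)))"
proof -
  have "det_on V (\<lambda>x y. \<Sum>z\<in>S x. c x z * r x z y) =
    (\<Sum>p | p permutes V. of_int (sign p) *
       (\<Sum>f\<in>Pi\<^sub>E V S. \<Prod>x\<in>V. c x (f x) * r x (f x) (p x)))"
    unfolding det_on_def by (subst prod_sum_PiE) (use assms in auto)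
  also have "\<dots> = (\<Sum>f\<in>Pi\<^sub>E V S. \<Sum>p | p permutes V. of_int (sign p) *
       (\<Prod>x\<in>V. c x (f x) * r x (f x) (p x)))"
    unfolding sum_distrib_left by (rule sum.swap)
  also have "\<dots> = (\<Sum>f\<in>Pi\<^sub>E V S. (\<Prod>x\<in>V. c x (f x)) * det_on V (\<lambda>x. r x (f x)))"
    unfolding det_on_def sum_distrib_left prod.distrib by (simp add: ac_simps)
  finally show ?thesis .
qed

lemma sum_of_bool_eq_mult:
  fixes g :: "'a \<Rightarrow> 'r::comm_ring_1"
  assumes "finite V" "a \<in> V"
  shows "(\<Sum>y\<in>V. of_bool (y = a) * g y) = g a"
proof -
  have "V \<inter> {y. y = a} = {a}" using assms(2) by auto
  then show ?thesis by (simp add: sum_of_bool_mult_eq[OF assms(1)])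
qed

section \<open>The expansion of the reduced Laplacian\<close>

text \<open>
  An arborescence with root \<open>v\<close> is the same thing as the map that sends each vertex to the next one
  on its way to \<open>v\<close>. The root is mapped to itself, so that this is a self-map of \<open>V\<close> whose iterates are
  available; it contributes no arc.
\<close>

definition parent_maps :: "'a set \<Rightarrow> 'a \<Rightarrow> ('a \<Rightarrow> 'a) set" where
  "parent_maps V v = {f \<in> V \<rightarrow>\<^sub>E V. f v = v \<and> (\<forall>x\<in>V. \<exists>k. (f ^^ k) x = v)}"

text \<open>
  The Laplacian with row and column \<open>v\<close> replaced by those of the identity matrix. Its determinant is
  the principal minor at \<open>v\<close>, but the index set is still \<open>V\<close>.
\<close>

definition reduced_laplacian :: "'a set \<Rightarrow> ('a \<times> 'a \<Rightarrow> 'r::comm_ring_1) \<Rightarrow> 'a \<Rightarrow> 'a \<Rightarrow> 'a \<Rightarrow> 'r" where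
  "reduced_laplacian V w v x y =
    (if x = v \<or> y = v then of_bool (x = y) else of_bool (x = y) * (\<Sum>z\<in>V. w (x, z)) - w (x, y))"

text \<open>
  The reduced Laplacian of the digraph whose only arcs are \<open>(x, f x)\<close>, each of weight \<open>1\<close>.
\<close>

definition parent_matrix :: "'a \<Rightarrow> ('a \<Rightarrow> 'a) \<Rightarrow> 'a \<Rightarrow> 'a \<Rightarrow> 'r::comm_ring_1" where
  "parent_matrix v f x y =
    (if x = v \<or> y = v then of_bool (x = y) else of_bool (y = x) - of_bool (y = f x))"

lemma no_fixpoint_if_orbit_reaches:
  assumes "(f ^^ k) x = v" "x \<noteq> v"
  shows "f x \<noteq> x"
proof
  assume "f x = x"
  then have "(f ^^ k) x = x" by (induction k) auto
  then show False using assms by simp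
qed

text \<open>
  Suppose that all orbits of \<open>f\<close> reach \<open>v\<close>. A permutation that meets only nonzero entries maps each
  vertex \<open>x\<close> to \<open>x\<close> or \<open>f x\<close> and fixes \<open>v\<close>; by induction on the number of steps to \<open>v\<close> it fixes
  \<open>x\<close>, since otherwise it would map both \<open>x\<close> and \<open>f x\<close> to \<open>f x\<close>. So only the diagonal counts. If
  some orbit misses \<open>v\<close>, the set \<open>C\<close> of the vertices whose orbits miss \<open>v\<close> satisfies
  \<open>f x \<in> C \<longleftrightarrow> x \<in> C\<close> for \<open>x \<noteq> v\<close>, so its indicator vector lies in the kernel.
\<close>

lemma det_on_parent_matrix:
  assumes fin: "finite V" and v: "v \<in> V" and f: "f \<in> V \<rightarrow>\<^sub>E V" and fv: "f v = v"
  shows "det_on V (parent_matrix v f) = (of_bool (f \<in> parent_maps V v) :: 'r::comm_ring_1)"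
proof (cases "f \<in> parent_maps V v")
  case True
  then have reach: "\<exists>k. (f ^^ k) x = v" if "x \<in> V" for x
    using that by (auto simp: parent_maps_def)
  have "det_on V (parent_matrix v f :: _ \<Rightarrow> _ \<Rightarrow> 'r) = (\<Prod>x\<in>V. parent_matrix v f x x)"
  proof (rule det_on_eq_diagonal_product[OF fin])
    fix p assume p: "p permutes V" "p \<noteq> id"
    show "\<exists>x\<in>V. (parent_matrix v f x (p x) :: 'r) = 0"
    proof (rule ccontr)
      assume neg: "\<not> ?thesis"
      have step: "p x = x \<or> p x = f x" if "x \<in> V" for x
        using neg that fv by (auto simp: parent_matrix_def split: if_splits)
      have "p x = x" if "x \<in> V" "(f ^^ k) x = v" for k x
        using that
      proof (induction k arbitrary: x)
        case 0
        then show ?case using step[of v] fv by auto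
      next
        case (Suc k)
        have "(f ^^ k) (f x) = v" using Suc.prems(2) by (simp add: funpow_swap1)
        then have "p (f x) = f x" using Suc.IH[of "f x"] Suc.prems(1) f by auto
        then show ?case
          using step[OF Suc.prems(1)] injD[OF permutes_inj[OF p(1)], of x "f x"] by auto
      qed
      then have "p x = x" for x
        using reach[of x] permutes_not_in[OF p(1), of x] by (cases "x \<in> V") auto
      then show False using p(2) by auto
    qed
  qed
  also have "\<dots> = 1"
    using reach no_fixpoint_if_orbit_reaches[of _ f _ v]
    by (intro prod.neutral ballI) (fastforce simp: parent_matrix_def)
  finally show ?thesis using True by simp
next
  case False
  define C where "C = {x \<in> V. \<forall>k. (f ^^ k) x \<noteq> v}"
  obtain c where c: "c \<in> C"
    using False f fv by (auto simp: parent_maps_def C_def)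
  have vC: "v \<notin> C" by (auto simp: C_def intro: exI[of _ 0])
  have fC: "f x \<in> C \<longleftrightarrow> x \<in> C" if "x \<in> V" "x \<noteq> v" for x
  proof -
    have "(f ^^ k) (f x) = v \<longleftrightarrow> (f ^^ Suc k) x = v" for k
      by (simp add: funpow_swap1)
    \<comment> \<open>Since \<open>x \<noteq> v\<close>, the orbit of \<open>x\<close> can only reach \<open>v\<close> after passing through \<open>f x\<close>.\<close>
    moreover have "(\<exists>k. (f ^^ k) x = v) \<longleftrightarrow> (\<exists>k. (f ^^ Suc k) x = v)"
      using that(2) by (metis funpow_0 not0_implies_Suc)
    ultimately have "(\<exists>k. (f ^^ k) (f x) = v) \<longleftrightarrow> (\<exists>k. (f ^^ k) x = v)"
      by blast
    then show ?thesis using that f by (auto simp: C_def)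
  qed
  have "det_on V (parent_matrix v f) = (0 :: 'r)"
  proof (rule det_on_eq_0_if_kernel[OF fin, of c "\<lambda>x. of_bool (x \<in> C)"])
    show "c \<in> V" "of_bool (c \<in> C) = (1 :: 'r)" using c by (auto simp: C_def)
    fix x assume x: "x \<in> V"
    show "(\<Sum>y\<in>V. parent_matrix v f x y * of_bool (y \<in> C)) = (0 :: 'r)"
    proof (cases "x = v")
      case True
      then show ?thesis using vC by (intro sum.neutral) (auto simp: parent_matrix_def)
    next
      case False
      have "(\<Sum>y\<in>V. parent_matrix v f x y * of_bool (y \<in> C)) =
          (\<Sum>y\<in>V. of_bool (y = x) * of_bool (y \<in> C) - of_bool (y = f x) * of_bool (y \<in> C) :: 'r)"
        using vC False by (intro sum.cong) (auto simp: parent_matrix_def)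
      also have "\<dots> = of_bool (x \<in> C) - of_bool (f x \<in> C)"
        unfolding sum_subtractf
        by (simp only: sum_of_bool_eq_mult[OF fin x] sum_of_bool_eq_mult[OF fin PiE_mem[OF f x]])
      finally show ?thesis using fC[OF x False] by simp
    qed
  qed
  then show ?thesis using False by simp
qed

text \<open>
  Row \<open>x\<close> of the reduced Laplacian is the sum of the rows of parent matrices for the possible values
  \<open>f x = z\<close>, weighted by \<open>w (x, z)\<close>. Expanding all rows gives one term for each self-map that fixes
  \<open>v\<close>, and the previous lemma leaves exactly the parent maps. Loops drop out by themselves: the row
  for \<open>f x = x\<close> is zero.
\<close>

lemma det_reduced_laplacian:
  assumes fin: "finite V" and v: "v \<in> V"
  shows "det_on V (reduced_laplacian V w v) = (\<Sum>f\<in>parent_maps V v. \<Prod>x\<in>V - {v}. w (x, f x))"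
proof -
  define S where "S = (\<lambda>x. if x = v then {v} else V)"
  define c where "c = (\<lambda>x z. if x = v then 1 else w (x, z))"
  define r :: "'a \<Rightarrow> 'a \<Rightarrow> 'a \<Rightarrow> 'b" where "r = (\<lambda>x z. parent_matrix v (\<lambda>_. z) x)"
  have "det_on V (reduced_laplacian V w v) = det_on V (\<lambda>x y. \<Sum>z\<in>S x. c x z * r x z y)"
  proof (rule det_on_cong)
    fix x y assume "x \<in> V" "y \<in> V"
    show "reduced_laplacian V w v x y = (\<Sum>z\<in>S x. c x z * r x z y)"
    proof (cases "x = v \<or> y = v")
      case True
      then show ?thesis
        by (auto simp: reduced_laplacian_def S_def c_def r_def parent_matrix_def)
    next
      case False
      have "(\<Sum>z\<in>S x. c x z * r x z y) =
          (\<Sum>z\<in>V. of_bool (x = y) * w (x, z) - of_bool (z = y) * w (x, z))"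
        using False by (auto simp: S_def c_def r_def parent_matrix_def algebra_simps intro!: sum.cong)
      also have "\<dots> = of_bool (x = y) * (\<Sum>z\<in>V. w (x, z)) - w (x, y)"
        using sum_of_bool_eq_mult[OF fin \<open>y \<in> V\<close>, of "\<lambda>z. w (x, z)"]
        by (simp add: sum_subtractf sum_distrib_left)
      finally show ?thesis using False by (simp add: reduced_laplacian_def)
    qed
  qed
  also have "\<dots> = (\<Sum>f\<in>Pi\<^sub>E V S. (\<Prod>x\<in>V. c x (f x)) * det_on V (\<lambda>x. r x (f x)))"
    by (rule det_on_row_expansion) (auto simp: S_def fin)
  also have "\<dots> = (\<Sum>f\<in>Pi\<^sub>E V S. (\<Prod>x\<in>V - {v}. w (x, f x)) * of_bool (f \<in> parent_maps V v))"
  proof (intro sum.cong refl arg_cong2[where f = "(*)"])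
    fix f assume f: "f \<in> Pi\<^sub>E V S"
    then have "f \<in> V \<rightarrow>\<^sub>E V" "f v = v"
      using v by (fastforce simp: S_def PiE_iff split: if_splits)+
    moreover have "(\<lambda>x. r x (f x)) = parent_matrix v f"
      by (auto simp: fun_eq_iff r_def parent_matrix_def)
    ultimately show "det_on V (\<lambda>x. r x (f x)) = of_bool (f \<in> parent_maps V v)"
      using det_on_parent_matrix[OF fin v, of f, where 'r = 'b] by simp
    show "(\<Prod>x\<in>V. c x (f x)) = (\<Prod>x\<in>V - {v}. w (x, f x))"
      by (subst prod.remove[OF fin v]) (auto simp: c_def intro!: prod.cong)
  qed
  also have "\<dots> = (\<Sum>f\<in>parent_maps V v. \<Prod>x\<in>V - {v}. w (x, f x))"
  proof (rule sum.mono_neutral_cong_right)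
    show "finite (Pi\<^sub>E V S)" by (intro finite_PiE) (auto simp: fin S_def)
    show "parent_maps V v \<subseteq> Pi\<^sub>E V S"
      by (auto simp: parent_maps_def S_def PiE_iff extensional_def)
  qed auto
  finally show ?thesis .
qed

section \<open>Spanning arborescences and parent maps\<close>

definition arborescence_of :: "'a set \<Rightarrow> 'a \<Rightarrow> ('a \<Rightarrow> 'a) \<Rightarrow> ('a, 'a \<times> 'a) pre_digraph" where
  "arborescence_of V v f =
    \<lparr>verts = V, arcs = (\<lambda>x. (x, f x)) ` (V - {v}), tail = fst, head = snd\<rparr>"

text \<open>
  The first repetition in an orbit gives a periodic point, and the least period makes the cycle
  simple.
\<close>

lemma finite_self_map_has_simple_periodic_orbit:
  assumes "finite S" "s \<in> S" and g: "\<And>x. x \<in> S \<Longrightarrow> g x \<in> S"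
  obtains y k where "y \<in> S" "k > 0" "(g ^^ k) y = y" "inj_on (\<lambda>i. (g ^^ i) y) {..<k}"
proof -
  have in_S: "(g ^^ i) x \<in> S" if "x \<in> S" for i x
    using that by (induction i) (auto simp: g)
  have "\<not> inj (\<lambda>i. (g ^^ i) s)"
  proof
    assume "inj (\<lambda>i. (g ^^ i) s)"
    moreover have "finite (range (\<lambda>i. (g ^^ i) s))"
      using in_S[OF assms(2)] by (intro finite_subset[OF _ assms(1)]) auto
    ultimately show False using finite_imageD by fastforce
  qed
  then obtain a b where ab: "(g ^^ a) s = (g ^^ b) s" "a < b"
    unfolding inj_def by (metis linorder_neqE_nat)
  define y where "y = (g ^^ a) s"
  have y: "y \<in> S" using in_S assms(2) by (auto simp: y_def)
  have per: "(g ^^ (b - a)) y = y"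
    using ab unfolding y_def by (metis funpow_add comp_apply le_add_diff_inverse2 less_imp_le_nat)
  define k where "k = (LEAST k. k > 0 \<and> (g ^^ k) y = y)"
  have k: "k > 0 \<and> (g ^^ k) y = y"
    unfolding k_def by (rule LeastI[of _ "b - a"]) (use per ab in auto)
  have least: "j \<ge> k" if "j > 0" "(g ^^ j) y = y" for j
    unfolding k_def by (rule Least_le) (use that in auto)
  have "inj_on (\<lambda>i. (g ^^ i) y) {..<k}"
  proof (rule linorder_inj_onI')
    fix i j assume ij: "i \<in> {..<k}" "j \<in> {..<k}" "i < j"
    show "(g ^^ i) y \<noteq> (g ^^ j) y"
    proof
      assume eq: "(g ^^ i) y = (g ^^ j) y"
      have "(g ^^ (k - j + i)) y = (g ^^ (k - j + j)) y"
        by (simp only: funpow_add comp_apply eq)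
      then have "(g ^^ (k - j + i)) y = y" using k ij by simp
      then show False using least[of "k - j + i"] ij by simp
    qed
  qed
  then show thesis using that y k by blast
qed

text \<open>
  A set of vertices in which one can always move on along an arc contains a directed cycle, which
  is a cycle of the underlying graph. Cycles of length \<open>1\<close> and \<open>2\<close> arise as well: they are
  loops and pairs of opposite arcs.
\<close>

lemma underlying_cycle_if_successor_map:
  assumes T: "tail T = fst" "head T = snd"
    and S: "finite S" "s \<in> S" "\<And>x. x \<in> S \<Longrightarrow> g x \<in> S" "\<And>x. x \<in> S \<Longrightarrow> (x, g x) \<in> arcs T"
  shows "\<exists>us es. underlying_cycle T us es"
proof -
  obtain y k where y: "y \<in> S" "k > 0" "(g ^^ k) y = y" "inj_on (\<lambda>i. (g ^^ i) y) {..<k}"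
    by (rule finite_self_map_has_simple_periodic_orbit[OF S(1-3)])
  have in_S: "(g ^^ i) y \<in> S" for i
    using y(1) by (induction i) (auto simp: S(3))
  define us where "us = map (\<lambda>i. (g ^^ i) y) [0..<k]"
  define es where "es = map (\<lambda>x. (x, g x)) us"
  have dist: "distinct us"
    using y(4) by (auto simp: us_def distinct_map atLeast0LessThan)
  have next_vertex: "us ! (Suc i mod length us) = g (us ! i)" if "i < length us" for i
    using that y(3) by (cases "Suc i = k") (auto simp: us_def)
  have "underlying_cycle T us es"
    unfolding underlying_cycle_def
  proof (intro conjI allI impI)
    show "us \<noteq> []" using y(2) by (simp add: us_def)
    show "distinct es" using dist by (auto simp: es_def distinct_map inj_on_def)
    show "set es \<subseteq> arcs T" using S(4) in_S by (auto simp: es_def us_def)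
    fix i assume "i < length us"
    then show "{tail T (es ! i), head T (es ! i)} = {us ! i, us ! (Suc i mod length us)}"
      using next_vertex[of i] by (simp add: es_def T)
  qed (use dist in \<open>auto simp: es_def\<close>)
  then show ?thesis by blast
qed

text \<open>
  At a vertex of maximal depth on a cycle, both incident cycle edges must leave that vertex, because
  the tail of an arc is deeper than its head. As each vertex has at most one outgoing arc, the two
  edges coincide, so the cycle is a loop; but a loop does not decrease the depth.
\<close>

lemma no_underlying_cycle_if_depth:
  fixes d :: "'a \<Rightarrow> nat"
  assumes uniq: "\<And>e e'. e \<in> arcs T \<Longrightarrow> e' \<in> arcs T \<Longrightarrow> tail T e = tail T e' \<Longrightarrow> e = e'"
    and depth: "\<And>e. e \<in> arcs T \<Longrightarrow> d (head T e) < d (tail T e)"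
  shows "\<not> underlying_cycle T us es"
proof
  assume cyc: "underlying_cycle T us es"
  define n where "n = length us"
  have n: "n > 0" "length us = n" "length es = n" and dist: "distinct us" "distinct es"
    and es: "set es \<subseteq> arcs T"
    and ends: "\<And>i. i < n \<Longrightarrow> {tail T (es ! i), head T (es ! i)} = {us ! i, us ! (Suc i mod n)}"
    using cyc by (auto simp: underlying_cycle_def n_def)
  have "finite (d ` set us)" "d ` set us \<noteq> {}" using n by auto
  from Max_in[OF this] obtain u where u: "u \<in> set us" "d u = Max (d ` set us)" by force
  have max: "d x \<le> d u" if "x \<in> set us" for x
    using that by (simp add: u(2))
  obtain i where i: "i < n" "us ! i = u"
    using u(1) n by (auto simp: in_set_conv_nth)
  \<comment> \<open>The cycle edge that enters position \<open>i\<close> is the one with index \<open>i - 1\<close> modulo \<open>n\<close>.\<close>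
  define j where "j = (if i = 0 then n - 1 else i - 1)"
  have j: "j < n" "Suc j mod n = i" using i n(1) by (auto simp: j_def)
  have leaves: "tail T (es ! l) = u" if "l < n" "u \<in> {us ! l, us ! (Suc l mod n)}" for l
  proof (rule ccontr)
    assume "tail T (es ! l) \<noteq> u"
    moreover have "u \<in> {tail T (es ! l), head T (es ! l)}"
      unfolding ends[OF that(1)] by (rule that(2))
    ultimately have "head T (es ! l) = u" by simp
    moreover have "es ! l \<in> arcs T" using es that(1) n by auto
    ultimately have "d u < d (tail T (es ! l))" using depth by metis
    have "tail T (es ! l) \<in> {us ! l, us ! (Suc l mod n)}"
      unfolding ends[OF that(1), symmetric] by simp
    moreover have "us ! l \<in> set us" "us ! (Suc l mod n) \<in> set us"
      using that(1) n(1,2) by simp_all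
    ultimately have "tail T (es ! l) \<in> set us" by auto
    then have "d (tail T (es ! l)) \<le> d u" by (rule max)
    with \<open>d u < _\<close> show False by simp
  qed
  have "es ! i = es ! j"
    by (rule uniq) (use leaves[of i] leaves[of j] i j es n in auto)
  then have "i = j" using dist(2) i j n by (simp add: nth_eq_iff_index_eq)
  then have "{tail T (es ! i), head T (es ! i)} = {u}"
    using ends[OF i(1)] i j by simp
  then have "head T (es ! i) = tail T (es ! i)" by blast
  moreover have "es ! i \<in> arcs T" using es i n by auto
  ultimately show False using depth[of "es ! i"] by simp
qed

text \<open>
  The number of steps to the root decreases along each arc. This excludes cycles by the previous
  lemma, and by induction on it every vertex is connected with the root.
\<close>

lemma spanning_arborescence_of_parent_map:
  assumes v: "v \<in> V" and f: "f \<in> parent_maps V v"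
    and D: "D = symmetric_digraph (V, {{g, h} | g h. g \<in> V \<and> h \<in> V})"
  shows "spanning_arborescence D v (arborescence_of V v f)"
proof -
  let ?T = "arborescence_of V v f"
  have fV: "f x \<in> V" if "x \<in> V" for x using f that by (auto simp: parent_maps_def)
  have reach: "\<exists>k. (f ^^ k) x = v" if "x \<in> V" for x using f that by (auto simp: parent_maps_def)
  define d where "d x = (LEAST k. (f ^^ k) x = v)" for x
  have depth: "d (f x) < d x" if x: "x \<in> V" "x \<noteq> v" for x
  proof -
    have dx: "(f ^^ d x) x = v" unfolding d_def by (rule LeastI_ex[OF reach[OF x(1)]])
    then obtain k where k: "d x = Suc k" using x by (cases "d x") auto
    then have "(f ^^ k) (f x) = v" using dx by (simp add: funpow_swap1)
    then have "d (f x) \<le> k" unfolding d_def by (rule Least_le)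
    then show ?thesis using k by simp
  qed
  have wf: "wf_digraph ?T" by unfold_locales (auto simp: arborescence_of_def fV)
  have "wf_digraph D" by unfold_locales (auto simp: D symmetric_digraph_def doubleton_eq_iff)
  then have span: "spanning ?T D"
    using wf fV by (auto simp: spanning_def subgraph_def compatible_def arborescence_of_def
        D symmetric_digraph_def)
  interpret M: wf_digraph "with_proj (mk_symmetric ?T)"
    by unfold_locales (auto simp: mk_symmetric_def arborescence_of_def fV)
  have adj: "x \<rightarrow>\<^bsub>mk_symmetric ?T\<^esub> f x" "f x \<rightarrow>\<^bsub>mk_symmetric ?T\<^esub> x" if "x \<in> V" "x \<noteq> v" for x
    using that by (force simp: mk_symmetric_def arborescence_of_def arcs_ends_conv)+
  have conn: "x \<rightarrow>\<^sup>*\<^bsub>mk_symmetric ?T\<^esub> v \<and> v \<rightarrow>\<^sup>*\<^bsub>mk_symmetric ?T\<^esub> x" if "x \<in> V" for x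
    using that
  proof (induction "d x" arbitrary: x rule: less_induct)
    case less
    show ?case
    proof (cases "x = v")
      case True
      then show ?thesis using v by (auto simp: reachable_def mk_symmetric_def arborescence_of_def)
    next
      case False
      then have "f x \<rightarrow>\<^sup>*\<^bsub>mk_symmetric ?T\<^esub> v \<and> v \<rightarrow>\<^sup>*\<^bsub>mk_symmetric ?T\<^esub> f x"
        using less depth fV by blast
      then show ?thesis using adj[OF less.prems False] M.adj_reachable_trans M.reachable_adj_trans by metis
    qed
  qed
  have "verts (with_proj (mk_symmetric ?T)) = V"
    by (simp add: mk_symmetric_def arborescence_of_def)
  then have "connected ?T"
    unfolding connected_def using v conn M.reachable_trans by (intro strongly_connectedI) blast+
  moreover have "\<not> underlying_cycle ?T us es" for us es
    by (rule no_underlying_cycle_if_depth[of _ d])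
      (auto simp: arborescence_of_def intro: depth)
  moreover have "out_degree ?T x = 1" if "x \<in> V" "x \<noteq> v" for x
  proof -
    have "out_arcs ?T x = {(x, f x)}" using that by (auto simp: out_arcs_def arborescence_of_def)
    then show ?thesis by (simp add: out_degree_def)
  qed
  ultimately show ?thesis
    using span v by (auto simp: spanning_arborescence_def underlying_tree_def arborescence_of_def)
qed

text \<open>
  Both properties of the parent map that are not immediate come from the absence of cycles. If the
  orbit of some vertex missed the root, its vertices would carry a cycle. If an arc left the root for
  \<open>y\<close>, then the map changed to send \<open>v\<close> to \<open>y\<close> would follow an arc at every vertex, and again there
  would be a cycle.
\<close>

lemma parent_map_of_spanning_arborescence:
  assumes fin: "finite V" and v: "v \<in> V"
    and D: "D = symmetric_digraph (V, {{g, h} | g h. g \<in> V \<and> h \<in> V})"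
    and T: "spanning_arborescence D v T"
  shows "\<exists>f\<in>parent_maps V v. T = arborescence_of V v f"
proof -
  have TV: "verts T = V" "tail T = fst" "head T = snd" "arcs T \<subseteq> V \<times> V"
    using T by (auto simp: spanning_arborescence_def spanning_def subgraph_def compatible_def
        D symmetric_digraph_def doubleton_eq_iff)
  have no_cycle: "\<not> underlying_cycle T us es" for us es
    using T by (auto simp: spanning_arborescence_def underlying_tree_def)
  have "\<exists>y. out_arcs T x = {(x, y)}" if "x \<in> V - {v}" for x
  proof -
    have "card (out_arcs T x) = 1"
      using T that TV by (auto simp: spanning_arborescence_def out_degree_def)
    then obtain e where "out_arcs T x = {e}" by (auto simp: card_1_singleton_iff)
    moreover then have "fst e = x" using TV by (auto simp: out_arcs_def)
    ultimately show ?thesis by (metis prod.collapse)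
  qed
  then have "\<forall>x\<in>V - {v}. \<exists>y. out_arcs T x = {(x, y)}" by blast
  from bchoice[OF this] obtain h
    where h: "\<And>x. x \<in> V - {v} \<Longrightarrow> out_arcs T x = {(x, h x)}" by blast
  define f where "f = (\<lambda>x\<in>V. if x = v then v else h x)"
  have arcs_out: "(x, y) \<in> arcs T \<longleftrightarrow> y = f x" if "x \<in> V" "x \<noteq> v" for x y
  proof -
    have "(x, y) \<in> arcs T \<longleftrightarrow> (x, y) \<in> out_arcs T x" by (simp add: out_arcs_def TV(2))
    then show ?thesis using h[of x] that by (simp add: f_def)
  qed
  have fV: "f x \<in> V" if "x \<in> V" for x
  proof (cases "x = v")
    case True
    then show ?thesis using v by (simp add: f_def)
  next
    case False
    then have "(x, f x) \<in> arcs T" by (simp add: arcs_out[OF that])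
    then show ?thesis using TV(4) by auto
  qed
  have funpow_V: "(f ^^ k) x \<in> V" if "x \<in> V" for k x
    using that by (induction k) (auto simp: fV)
  have reach: "\<exists>k. (f ^^ k) x = v" if x: "x \<in> V" for x
  proof (rule ccontr)
    assume "\<not> ?thesis"
    then have orbit: "(f ^^ k) x \<in> V" "(f ^^ k) x \<noteq> v" for k
      using funpow_V[OF x] by auto
    have "\<exists>us es. underlying_cycle T us es"
    proof (rule underlying_cycle_if_successor_map[OF TV(2,3)])
      show "finite (range (\<lambda>k. (f ^^ k) x))"
        by (rule finite_subset[OF _ fin]) (use orbit in auto)
      show "x \<in> range (\<lambda>k. (f ^^ k) x)" by (rule range_eqI[of _ _ 0]) simp
      fix y assume "y \<in> range (\<lambda>k. (f ^^ k) x)"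
      then obtain k where k: "y = (f ^^ k) x" by blast
      show "f y \<in> range (\<lambda>k. (f ^^ k) x)"
        by (rule range_eqI[of _ _ "Suc k"]) (simp add: k)
      show "(y, f y) \<in> arcs T" using orbit[of k] by (simp add: k arcs_out)
    qed
    then show False using no_cycle by blast
  qed
  have root: "(v, y) \<notin> arcs T" for y
  proof
    assume vy: "(v, y) \<in> arcs T"
    then have y: "y \<in> V" using TV(4) by auto
    have "\<exists>us es. underlying_cycle T us es"
    proof (rule underlying_cycle_if_successor_map[OF TV(2,3) fin v])
      fix x assume "x \<in> V"
      then show "(f(v := y)) x \<in> V" "(x, (f(v := y)) x) \<in> arcs T"
        using y vy fV by (auto simp: arcs_out)
    qed
    then show False using no_cycle by blast
  qed
  have "f \<in> parent_maps V v"
  proof -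
    have "f \<in> V \<rightarrow>\<^sub>E V" using fV by (auto simp: PiE_iff) (simp add: f_def)
    moreover have "f v = v" by (simp add: f_def v)
    ultimately show ?thesis using reach by (simp add: parent_maps_def)
  qed
  moreover have "arcs T = (\<lambda>x. (x, f x)) ` (V - {v})"
  proof (rule Set.set_eqI)
    fix e :: "'a \<times> 'a"
    obtain x y where e: "e = (x, y)" by (cases e)
    show "e \<in> arcs T \<longleftrightarrow> e \<in> (\<lambda>x. (x, f x)) ` (V - {v})"
    proof (cases "x \<in> V - {v}")
      case True
      then show ?thesis by (auto simp: e arcs_out)
    next
      case False
      then have "e \<notin> arcs T" using root TV(4) by (auto simp: e)
      then show ?thesis using False by (auto simp: e)
    qed
  qed
  then have "T = arborescence_of V v f"
    by (intro pre_digraph.equality) (simp_all add: arborescence_of_def TV(1-3))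
  ultimately show ?thesis by blast
qed

text \<open>
  Tutte's matrix-tree theorem: written in terms of parent maps, the sum over the spanning
  arborescences is the expansion of the minor.
\<close>

theorem weighted_matrix_tree:
  fixes w :: "'a \<times> 'a \<Rightarrow> 'r::comm_ring_1"
  assumes fin: "finite V" and v: "v \<in> V"
  shows "weighted_complexity (V, {{g, h} | g h. g \<in> V \<and> h \<in> V}) w v =
    det_on V (reduced_laplacian V w v)"
proof -
  let ?D = "symmetric_digraph (V, {{g, h} | g h. g \<in> V \<and> h \<in> V})"
  have "bij_betw (arborescence_of V v) (parent_maps V v) {T. spanning_arborescence ?D v T}"
    unfolding bij_betw_def
  proof
    show "inj_on (arborescence_of V v) (parent_maps V v)"
    proof (rule inj_onI)
      fix f g assume fg: "f \<in> parent_maps V v" "g \<in> parent_maps V v"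
        "arborescence_of V v f = arborescence_of V v g"
      then have arcs: "(\<lambda>x. (x, f x)) ` (V - {v}) = (\<lambda>x. (x, g x)) ` (V - {v})"
        by (simp add: arborescence_of_def)
      have "f x = g x" if "x \<in> V" for x
      proof (cases "x = v")
        case True
        then show ?thesis using fg(1,2) by (simp add: parent_maps_def)
      next
        case False
        then have "(x, f x) \<in> (\<lambda>x. (x, g x)) ` (V - {v})"
          unfolding arcs[symmetric] using that by simp
        then show ?thesis by blast
      qed
      moreover have "f \<in> V \<rightarrow>\<^sub>E V" "g \<in> V \<rightarrow>\<^sub>E V"
        using fg(1,2) by (simp_all add: parent_maps_def)
      ultimately show "f = g" by (metis PiE_ext)
    qed
    show "arborescence_of V v ` parent_maps V v = {T. spanning_arborescence ?D v T}"
      using spanning_arborescence_of_parent_map[OF v _ refl]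
        parent_map_of_spanning_arborescence[OF fin v refl] by blast
  qed
  then have "weighted_complexity (V, {{g, h} | g h. g \<in> V \<and> h \<in> V}) w v =
      (\<Sum>f\<in>parent_maps V v. \<Prod>e\<in>arcs (arborescence_of V v f). w e)"
    unfolding weighted_complexity_def by (rule sum.reindex_bij_betw[symmetric])
  also have "\<dots> = (\<Sum>f\<in>parent_maps V v. \<Prod>x\<in>V - {v}. w (x, f x))"
    by (intro sum.cong refl) (simp add: arborescence_of_def prod.reindex inj_on_def)
  finally show ?thesis by (simp add: det_reduced_laplacian[OF fin v])
qed

section \<open>Adding the all-ones matrix to a Laplacian\<close>

definition laplacian :: "'a set \<Rightarrow> ('a \<times> 'a \<Rightarrow> 'r::comm_ring_1) \<Rightarrow> 'a \<Rightarrow> 'a \<Rightarrow> 'r" where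
  "laplacian V w x y = of_bool (x = y) * (\<Sum>z\<in>V. w (x, z)) - w (x, y)"

text \<open>
  Let \<open>M\<close> be the Laplacian plus the all-ones matrix and \<open>n\<close> the number of vertices. As all row and
  column sums of the Laplacian are zero, those of \<open>M\<close> are \<open>n\<close>. Adding all columns of \<open>M\<close> to column
  \<open>v\<close> and then all rows to row \<open>v\<close>, which is the congruence with the matrix \<open>H\<close> of determinant
  \<open>1\<close>, therefore produces \<open>n\<^sup>2\<close> at \<open>(v, v)\<close>, \<open>n\<close> in the rest of row and column \<open>v\<close>, and leaves
  the Laplacian plus \<open>1\<close> elsewhere. The same matrix arises from the reduced Laplacian by the
  congruence with \<open>Q\<close>, whose determinant is \<open>n\<close>.
\<close>

lemma det_laplacian_plus_ones:
  fixes w :: "'a \<times> 'a \<Rightarrow> 'r::comm_ring_1"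
  assumes fin: "finite V" and v: "v \<in> V"
    and balanced: "\<And>y. y \<in> V \<Longrightarrow> (\<Sum>x\<in>V. w (x, y)) = (\<Sum>z\<in>V. w (y, z))"
  shows "det_on V (\<lambda>x y. laplacian V w x y + 1) =
    of_nat (card V) ^ 2 * det_on V (reduced_laplacian V w v)"
proof -
  let ?n = "of_nat (card V) :: 'r"
  let ?M = "\<lambda>x y. laplacian V w x y + 1" and ?A = "reduced_laplacian V w v"
  define H :: "'a \<Rightarrow> 'a \<Rightarrow> 'r" where "H x y = (if y = v then 1 else of_bool (x = y))" for x y
  define Q :: "'a \<Rightarrow> 'a \<Rightarrow> 'r" where
    "Q x y = (if x = v then (if y = v then ?n else 0) else if y = v then 1 else of_bool (y = x))" for x y
  have det_H: "det_on V H = 1"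
    by (subst det_on_diagonal_and_column[OF fin v]) (auto simp: H_def intro!: prod.neutral)
  have "(\<Prod>x\<in>V. Q x x) = ?n"
    by (subst prod.remove[OF fin v]) (simp add: Q_def)
  then have det_Q: "det_on V Q = ?n"
    by (subst det_on_diagonal_and_column[OF fin v]) (auto simp: Q_def)
  have row: "(\<Sum>y\<in>V. ?M x y) = ?n" if "x \<in> V" for x
    using sum_of_bool_eq_mult[OF fin that, of "\<lambda>_. \<Sum>z\<in>V. w (x, z)"]
    by (simp add: laplacian_def sum.distrib sum_subtractf eq_commute[of x])
  have column: "(\<Sum>x\<in>V. ?M x y) = ?n" if "y \<in> V" for y
    using sum_of_bool_eq_mult[OF fin that, of "\<lambda>x. \<Sum>z\<in>V. w (x, z)"]
    by (simp add: laplacian_def sum.distrib sum_subtractf balanced[OF that])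
  have MH: "(\<Sum>u\<in>V. ?M z u * H u y) = (if y = v then ?n else ?M z y)" if "z \<in> V" "y \<in> V" for z y
    using row[OF that(1)] sum_of_bool_eq_mult[OF fin that(2), of "?M z"]
    by (simp add: H_def mult.commute)
  have AQ: "(\<Sum>u\<in>V. ?A z u * Q y u) = (if z = v then Q y v else if y = v then 0 else ?M z y - 1)"
    if "z \<in> V" "y \<in> V" for z y
  proof (cases "z = v")
    case True
    then show ?thesis
      using sum_of_bool_eq_mult[OF fin v, of "Q y"]
      by (simp add: reduced_laplacian_def eq_commute[of v])
  next
    case False
    have "(\<Sum>u\<in>V. ?A z u * Q y u) = (\<Sum>u\<in>V. of_bool (u = y) * (of_bool (y \<noteq> v) * laplacian V w z u))"
      using False by (intro sum.cong) (auto simp: reduced_laplacian_def Q_def laplacian_def)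
    then show ?thesis
      using False sum_of_bool_eq_mult[OF fin that(2), of "\<lambda>u. of_bool (y \<noteq> v) * laplacian V w z u"]
      by simp
  qed
  have "(\<Sum>z\<in>V. H z x * (\<Sum>u\<in>V. ?M z u * H u y)) = (\<Sum>z\<in>V. Q x z * (\<Sum>u\<in>V. ?A z u * Q y u))"
    if x: "x \<in> V" and y: "y \<in> V" for x y
  proof (cases "x = v")
    case True
    have "(\<Sum>z\<in>V. H z x * (\<Sum>u\<in>V. ?M z u * H u y)) = (\<Sum>z\<in>V. if y = v then ?n else ?M z y)"
      by (intro sum.cong refl) (simp add: True H_def[of _ v] MH[OF _ y])
    also have "\<dots> = ?n * Q y v"
      using column[OF y] by (simp add: Q_def)
    also have "\<dots> = (\<Sum>z\<in>V. of_bool (z = v) * (?n * Q y v))"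
      by (rule sum_of_bool_eq_mult[OF fin v, symmetric])
    also have "\<dots> = (\<Sum>z\<in>V. Q x z * (\<Sum>u\<in>V. ?A z u * Q y u))"
      by (intro sum.cong refl) (auto simp: True Q_def[of v] AQ[OF _ y])
    finally show ?thesis .
  next
    case False
    have "(\<Sum>z\<in>V. H z x * (\<Sum>u\<in>V. ?M z u * H u y)) =
        (\<Sum>z\<in>V. of_bool (z = x) * (\<Sum>u\<in>V. ?M z u * H u y))"
      using False by (simp add: H_def)
    also have "\<dots> = (if y = v then ?n else ?M x y)"
      by (simp only: sum_of_bool_eq_mult[OF fin x] MH[OF x y])
    also have "\<dots> = Q y v + (if y = v then 0 else ?M x y - 1)"
      by (simp add: Q_def)
    also have "\<dots> = (\<Sum>z\<in>V. of_bool (z = v) * Q y v + of_bool (z = x) * (if y = v then 0 else ?M z y - 1))"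
      by (simp only: sum.distrib sum_of_bool_eq_mult[OF fin x] sum_of_bool_eq_mult[OF fin v])
    also have "\<dots> = (\<Sum>z\<in>V. Q x z * (\<Sum>u\<in>V. ?A z u * Q y u))"
      by (intro sum.cong refl) (use False in \<open>auto simp: Q_def[of x] AQ[OF _ y]\<close>)
    finally show ?thesis .
  qed
  then have "det_on V (\<lambda>x y. \<Sum>z\<in>V. H z x * (\<Sum>u\<in>V. ?M z u * H u y)) =
      det_on V (\<lambda>x y. \<Sum>z\<in>V. Q x z * (\<Sum>u\<in>V. ?A z u * Q y u))"
    by (rule det_on_cong)
  then have "det_on V ?M = ?n * (det_on V ?A * ?n)"
    by (simp only: det_on_mult[OF fin] det_on_transpose[OF fin, of H]
        det_on_transpose[OF fin, of Q] det_H det_Q mult_1 mult_1_right)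
  then show ?thesis by (simp add: power2_eq_square ac_simps)
qed

section \<open>Characters of finite abelian groups\<close>

text \<open>
  Characters of a subgroup, without a type or record for the subgroup, so that they can be extended
  step by step.
\<close>

definition partial_character :: "('a, 'm) monoid_scheme \<Rightarrow> 'a set \<Rightarrow> ('a \<Rightarrow> complex) \<Rightarrow> bool" where
  "partial_character G H \<chi> \<longleftrightarrow>
     (\<forall>x\<in>H. \<chi> x \<noteq> 0) \<and> (\<forall>x\<in>H. \<forall>y\<in>H. \<chi> (x \<otimes>\<^bsub>G\<^esub> y) = \<chi> x * \<chi> y)"

lemma complex_root_exists:
  assumes "k > 0"
  shows "\<exists>c::complex. c ^ k = z"
proof
  show "rcis (root k (cmod z)) (Arg z / of_nat k) ^ k = z"
    using assms by (simp add: DeMoivre2 rcis_cmod_Arg)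
qed

context comm_group
begin

lemma partial_character_one:
  assumes "subgroup H G" "partial_character G H \<chi>"
  shows "\<chi> \<one> = 1"
proof -
  have "\<one> \<in> H" using assms(1) by (rule subgroup.one_closed)
  then have "\<chi> (\<one> \<otimes> \<one>) = \<chi> \<one> * \<chi> \<one>" "\<chi> \<one> \<noteq> 0"
    using assms(2) unfolding partial_character_def by blast+
  then show ?thesis by simp
qed

lemma partial_character_pow:
  assumes "subgroup H G" "partial_character G H \<chi>" "h \<in> H"
  shows "h [^] (n::nat) \<in> H \<and> \<chi> (h [^] n) = \<chi> h ^ n"
proof (induction n)
  case 0
  show ?case using partial_character_one[OF assms(1,2)] subgroup.one_closed[OF assms(1)] by simp
next
  case (Suc n)
  then show ?case
    using assms subgroup.m_closed[OF assms(1)] by (simp add: partial_character_def)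
qed

text \<open>
  Extending a character \<open>\<chi>\<close> from \<open>H\<close> to the subgroup generated by \<open>H\<close> and \<open>a\<close>. With \<open>k\<close> the order of
  \<open>a\<close> modulo \<open>H\<close>, the value at \<open>a\<close> may be any \<open>k\<close>-th root \<open>c\<close> of \<open>\<chi> (a\<^sup>k)\<close>, and the extension is
  \<open>h a\<^sup>i \<mapsto> \<chi> h c\<^sup>i\<close>. This is well defined because \<open>a\<^sup>m \<in> H\<close> forces \<open>k\<close> to divide \<open>m\<close>, which gives
  \<open>\<chi> (a\<^sup>m) = c\<^sup>m\<close>.
\<close>

lemma partial_character_extend:
  assumes fin: "finite (carrier G)" and H: "subgroup H G" and \<chi>: "partial_character G H \<chi>"
    and a: "a \<in> carrier G" and k: "k > 0" "a [^] k \<in> H"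
    and least: "\<forall>j. 0 < j \<and> j < k \<longrightarrow> a [^] j \<notin> H"
    and c: "c ^ k = \<chi> (a [^] k)"
  shows "\<exists>K \<psi>. subgroup K G \<and> H \<subseteq> K \<and> a \<in> K \<and> partial_character G K \<psi> \<and>
    (\<forall>h\<in>H. \<psi> h = \<chi> h) \<and> \<psi> a = c"
proof -
  interpret H: subgroup H G by (rule H)
  have HG [simp]: "h \<in> carrier G" if "h \<in> H" for h using that by (rule H.mem_carrier)
  have \<chi>_mult: "\<chi> (x \<otimes> y) = \<chi> x * \<chi> y" if "x \<in> H" "y \<in> H" for x y
    using \<chi> that by (simp add: partial_character_def)
  have pow_a: "\<chi> (a [^] m) = c ^ m" if m: "a [^] m \<in> H" for m :: nat
  proof -
    let ?b = "(a [^] k) [^] (m div k)"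
    have b: "?b \<in> H" "\<chi> ?b = c ^ (k * (m div k))"
      using partial_character_pow[OF H \<chi> k(2), of "m div k"] by (simp_all add: power_mult c)
    have "?b \<otimes> a [^] (m mod k) = a [^] m"
      using a by (simp add: nat_pow_pow nat_pow_mult)
    then have "a [^] (m mod k) = inv ?b \<otimes> a [^] m"
      using a b(1) by (metis HG inv_solve_left nat_pow_closed)
    then have "a [^] (m mod k) \<in> H" using b(1) m by simp
    then have "m mod k = 0" using least k(1) by (meson gr0I mod_less_divisor)
    then have "m = k * (m div k)" by (metis add.right_neutral mult_div_mod_eq)
    then show ?thesis using b(2) a by (simp add: nat_pow_pow)
  qed
  have well_def_le: "\<chi> h * c ^ i = \<chi> h' * c ^ j"
    if hh: "h \<in> H" "h' \<in> H" "h \<otimes> a [^] i = h' \<otimes> a [^] j" "i \<le> j" for h h' and i j :: nat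
  proof -
    have "h \<otimes> a [^] i = (h' \<otimes> a [^] (j - i)) \<otimes> a [^] i"
      using hh a by (simp add: m_assoc nat_pow_mult)
    then have h: "h = h' \<otimes> a [^] (j - i)"
      using hh a by simp
    then have "a [^] (j - i) = inv h' \<otimes> h"
      using hh a by (metis HG inv_solve_left nat_pow_closed)
    then have "a [^] (j - i) \<in> H" using hh by simp
    then have "\<chi> h = \<chi> h' * c ^ (j - i)"
      using h \<chi>_mult[OF hh(2)] pow_a by simp
    then show ?thesis using hh(4) by (simp flip: power_add)
  qed
  have well_def: "\<chi> h * c ^ i = \<chi> h' * c ^ j"
    if "h \<in> H" "h' \<in> H" "h \<otimes> a [^] i = h' \<otimes> a [^] j" for h h' and i j :: nat
    using well_def_le[of h h' i j] well_def_le[of h' h j i] that by (cases "i \<le> j") auto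
  define K where "K = {h \<otimes> a [^] i | h i. h \<in> H \<and> i \<in> (UNIV :: nat set)}"
  have K_I: "h \<otimes> a [^] i \<in> K" if "h \<in> H" for h and i :: nat using that by (auto simp: K_def)
  define \<psi> where "\<psi> y = (SOME z. \<exists>h i. h \<in> H \<and> y = h \<otimes> a [^] (i::nat) \<and> z = \<chi> h * c ^ i)" for y
  have \<psi>: "\<psi> (h \<otimes> a [^] i) = \<chi> h * c ^ i" if "h \<in> H" for h and i :: nat
  proof -
    have "\<exists>h' i'. h' \<in> H \<and> h \<otimes> a [^] i = h' \<otimes> a [^] (i'::nat) \<and>
        \<psi> (h \<otimes> a [^] i) = \<chi> h' * c ^ i'"
      unfolding \<psi>_def by (rule someI[where x = "\<chi> h * c ^ i"]) (use that in blast)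
    then obtain h' i' where hi: "h' \<in> H" "h \<otimes> a [^] i = h' \<otimes> a [^] (i'::nat)"
        "\<psi> (h \<otimes> a [^] i) = \<chi> h' * c ^ i'"
      by blast
    show ?thesis using hi(3) well_def[OF that hi(1,2)] by simp
  qed
  have prod: "(h \<otimes> a [^] i) \<otimes> (h' \<otimes> a [^] j) = (h \<otimes> h') \<otimes> a [^] (i + j)"
    if "h \<in> H" "h' \<in> H" for h h' and i j :: nat
    using that a by (simp add: m_ac flip: nat_pow_mult)
  have K_mult: "x \<otimes> y \<in> K" "\<psi> (x \<otimes> y) = \<psi> x * \<psi> y" if xy: "x \<in> K" "y \<in> K" for x y
  proof -
    obtain h i h' j where e: "x = h \<otimes> a [^] (i::nat)" "y = h' \<otimes> a [^] (j::nat)" "h \<in> H" "h' \<in> H"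
      using xy by (auto simp: K_def)
    show "x \<otimes> y \<in> K" using e prod K_I by simp
    show "\<psi> (x \<otimes> y) = \<psi> x * \<psi> y" using e by (simp add: prod \<psi> \<chi>_mult power_add)
  qed
  have H_K: "h \<in> K" "\<psi> h = \<chi> h" if "h \<in> H" for h
    using K_I[OF that, of 0] \<psi>[OF that, of 0] that by simp_all
  have a_K: "a \<in> K" "\<psi> a = c"
    using K_I[OF H.one_closed, of 1] \<psi>[OF H.one_closed, of 1] a partial_character_one[OF H \<chi>]
    by simp_all
  have KG: "K \<subseteq> carrier G" using a by (auto simp: K_def)
  have K: "subgroup K G"
  proof (rule subgroupI[OF KG])
    show "K \<noteq> {}" using a_K by auto
    fix x assume x: "x \<in> K"
    \<comment> \<open>\<open>K\<close> is closed under products and \<open>G\<close> is finite, so inverses are powers.\<close>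
    have pow: "x [^] (n::nat) \<in> K" for n
      by (induction n) (simp_all add: H_K(1)[OF H.one_closed] K_mult(1) x)
    have "x [^] (order G - 1) \<otimes> x = x [^] order G"
      using x KG order_gt_0_iff_finite fin by (simp flip: nat_pow_Suc)
    also have "\<dots> = \<one>" by (rule pow_order_eq_1) (use x KG in auto)
    finally have "inv x = x [^] (order G - 1)"
      using x KG by (intro inv_equality) auto
    then show "inv x \<in> K" using pow by simp
  qed (rule K_mult(1))
  have "\<psi> x \<noteq> 0" if x: "x \<in> K" for x
  proof -
    have "\<psi> x * \<psi> (inv x) = \<psi> \<one>"
      using K_mult(2)[OF x subgroup.m_inv_closed[OF K x]] x KG by auto
    also have "\<dots> = 1" using H_K(2)[OF H.one_closed] partial_character_one[OF H \<chi>] by simp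
    finally show ?thesis by auto
  qed
  then have "partial_character G K \<psi>" using K_mult(2) by (simp add: partial_character_def)
  then show ?thesis using K H_K a_K by blast
qed

lemma least_power_in_subgroup:
  assumes "finite (carrier G)" "subgroup H G" "a \<in> carrier G"
  shows "\<exists>k::nat. k > 0 \<and> a [^] k \<in> H \<and> (\<forall>j. 0 < j \<and> j < k \<longrightarrow> a [^] j \<notin> H)"
proof -
  have "0 < order G \<and> a [^] order G \<in> H"
    using pow_order_eq_1[OF assms(3)] subgroup.one_closed[OF assms(2)] assms(1)
    by (simp add: order_gt_0_iff_finite)
  then show ?thesis
    using exists_least_iff[of "\<lambda>k. 0 < k \<and> a [^] k \<in> H"] by blast
qed

lemma in_characters_iff:
  "\<chi> \<in> characters G \<longleftrightarrow> \<chi> \<in> extensional (carrier G) \<and> partial_character G (carrier G) \<chi>"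
  by (auto simp: characters_def hom_def complex_units_def partial_character_def Pi_iff)

text \<open>
  The trivial character of the trivial subgroup extends to the subgroup generated by \<open>g\<close> with a
  value \<open>c \<noteq> 1\<close> at \<open>g\<close>, because the order \<open>k\<close> of \<open>g\<close> is at least \<open>2\<close> and there are \<open>k\<close> roots of unity to
  choose from. A subgroup of maximal size among those that carry a character with value other than
  \<open>1\<close> at \<open>g\<close> must be all of \<open>G\<close>, for otherwise that character could be extended once more.
\<close>

lemma character_separates:
  assumes fin: "finite (carrier G)" and g: "g \<in> carrier G" "g \<noteq> \<one>"
  shows "\<exists>\<chi>\<in>characters G. \<chi> g \<noteq> 1"
proof -
  define P where "P K \<longleftrightarrow> subgroup K G \<and> g \<in> K \<and> (\<exists>\<psi>. partial_character G K \<psi> \<and> \<psi> g \<noteq> 1)" for K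
  have triv: "subgroup {\<one>} G" by (rule triv_subgroup)
  obtain k :: nat where k: "k > 0" "g [^] k \<in> {\<one>}" "\<forall>j. 0 < j \<and> j < k \<longrightarrow> g [^] j \<notin> {\<one>}"
    using least_power_in_subgroup[OF fin triv g(1)] by blast
  have "k \<noteq> 1" using k(2) g by auto
  then have k1: "k > 1" using k(1) by simp
  have "card {z::complex. z ^ k = 1} = k" by (rule card_roots_unity_eq) (use k in simp)
  then have "{z::complex. z ^ k = 1} \<noteq> {1}" using k1 by auto
  then obtain c :: complex where c: "c ^ k = 1" "c \<noteq> 1" by fastforce
  have "\<exists>K \<psi>. subgroup K G \<and> {\<one>} \<subseteq> K \<and> g \<in> K \<and> partial_character G K \<psi> \<and>
    (\<forall>h\<in>{\<one>}. \<psi> h = 1) \<and> \<psi> g = c"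
    by (rule partial_character_extend[OF fin triv _ g(1) k])
      (auto simp: partial_character_def c)
  then obtain K0 where "P K0" using c(2) by (auto simp: P_def)
  moreover have "card K \<le> order G" if "P K" for K
    using that fin by (auto simp: P_def order_def intro!: card_mono dest: subgroup.subset)
  ultimately have "\<exists>K. P K \<and> (\<forall>L. P L \<longrightarrow> card L \<le> card K)"
    by (intro ex_has_greatest_nat[of P K0 card "Suc (order G)"]) (auto simp: less_Suc_eq_le)
  then obtain K where K: "P K" and max: "\<And>L. P L \<Longrightarrow> card L \<le> card K" by blast
  obtain \<psi> where \<psi>: "subgroup K G" "g \<in> K" "partial_character G K \<psi>" "\<psi> g \<noteq> 1"
    using K by (auto simp: P_def)
  have "K = carrier G"
  proof (rule ccontr)
    assume "K \<noteq> carrier G"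
    then obtain a where a: "a \<in> carrier G" "a \<notin> K"
      using subgroup.subset[OF \<psi>(1)] by blast
    obtain m :: nat where m: "m > 0" "a [^] m \<in> K" "\<forall>j. 0 < j \<and> j < m \<longrightarrow> a [^] j \<notin> K"
      using least_power_in_subgroup[OF fin \<psi>(1) a(1)] by blast
    obtain c where c: "c ^ m = \<psi> (a [^] m)" using complex_root_exists[OF m(1)] by blast
    obtain L \<phi> where L: "subgroup L G" "K \<subseteq> L" "a \<in> L" "partial_character G L \<phi>" "\<forall>h\<in>K. \<phi> h = \<psi> h"
      using partial_character_extend[OF fin \<psi>(1,3) a(1) m c] by blast
    have "\<phi> g \<noteq> 1" using L(5) \<psi>(2,4) by simp
    then have "P L" using L \<psi>(2) by (auto simp: P_def)
    moreover have "card K < card L"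
      using L a subgroup.subset[OF L(1)] by (intro psubset_card_mono finite_subset[OF _ fin]) auto
    ultimately show False using max[of L] by simp
  qed
  then have "restrict \<psi> (carrier G) \<in> characters G" "restrict \<psi> (carrier G) g \<noteq> 1"
    using \<psi> g by (auto simp: in_characters_iff partial_character_def)
  then show ?thesis by blast
qed

lemma character_mult:
  assumes "\<chi> \<in> characters G" "x \<in> carrier G" "y \<in> carrier G"
  shows "\<chi> (x \<otimes> y) = \<chi> x * \<chi> y"
  using assms by (simp add: in_characters_iff partial_character_def)

lemma character_one:
  assumes "\<chi> \<in> characters G"
  shows "\<chi> \<one> = 1"
  using assms partial_character_one[OF subgroup_self] by (simp add: in_characters_iff)

lemma character_inv:
  assumes "\<chi> \<in> characters G" "x \<in> carrier G"
  shows "\<chi> (inv x) * \<chi> x = 1"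
  using character_mult[OF assms(1), of "inv x" x] character_one[OF assms(1)] assms(2) by simp

lemma trivial_character_in_characters: "trivial_character G \<in> characters G"
  by (auto simp: in_characters_iff partial_character_def trivial_character_def)

lemma finite_characters:
  assumes fin: "finite (carrier G)"
  shows "finite (characters G)"
proof (rule finite_subset)
  have "\<chi> x ^ order G = 1" if "\<chi> \<in> characters G" "x \<in> carrier G" for \<chi> x
    using partial_character_pow[OF subgroup_self, of \<chi> x "order G"] that
      pow_order_eq_1[of x] character_one[of \<chi>] by (simp add: in_characters_iff)
  then show "characters G \<subseteq> carrier G \<rightarrow>\<^sub>E {z. z ^ order G = 1}"
    by (auto simp: in_characters_iff PiE_iff extensional_def)
  have "order G \<ge> 1" using fin by (simp add: order_gt_0_iff_finite Suc_le_eq)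
  then show "finite (carrier G \<rightarrow>\<^sub>E {z::complex. z ^ order G = 1})"
    by (intro finite_PiE fin finite_roots_unity)
qed

lemma sum_translate:
  assumes "a \<in> carrier G"
  shows "(\<Sum>x\<in>carrier G. f (a \<otimes> x)) = (\<Sum>x\<in>carrier G. f x)"
  using assms by (intro sum.reindex_bij_betw) (simp add: bij_betw_def inj_on_cmult surj_const_mult)

text \<open>
  Translating the summation variable by \<open>a\<close> multiplies the sum by \<open>\<chi> a\<close>; if some \<open>\<chi> a\<close> differs
  from \<open>1\<close>, the sum vanishes.
\<close>

lemma sum_character:
  assumes \<chi>: "\<chi> \<in> characters G"
  shows "(\<Sum>x\<in>carrier G. \<chi> x) = (if \<chi> = trivial_character G then of_nat (order G) else 0)"
proof (cases "\<chi> = trivial_character G")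
  case True
  then show ?thesis by (simp add: trivial_character_def order_def)
next
  case False
  have "\<exists>a\<in>carrier G. \<chi> a \<noteq> 1"
  proof (rule ccontr)
    assume "\<not> ?thesis"
    then have "\<chi> = trivial_character G"
      using \<chi> by (intro extensionalityI[of _ "carrier G"])
        (auto simp: in_characters_iff trivial_character_def)
    then show False using False by simp
  qed
  then obtain a where a: "a \<in> carrier G" "\<chi> a \<noteq> 1" by blast
  have "\<chi> a * (\<Sum>x\<in>carrier G. \<chi> x) = (\<Sum>x\<in>carrier G. \<chi> (a \<otimes> x))"
    by (simp add: sum_distrib_left character_mult[OF \<chi> a(1)])
  also have "\<dots> = (\<Sum>x\<in>carrier G. \<chi> x)" by (rule sum_translate[OF a(1)])
  finally show ?thesis using a(2) False by simp
qed

definition character_times :: "('a \<Rightarrow> complex) \<Rightarrow> ('a \<Rightarrow> complex) \<Rightarrow> 'a \<Rightarrow> complex" where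
  "character_times \<chi> \<psi> = (\<lambda>x\<in>carrier G. \<chi> x * \<psi> x)"

definition character_inverse :: "('a \<Rightarrow> complex) \<Rightarrow> 'a \<Rightarrow> complex" where
  "character_inverse \<chi> = (\<lambda>x\<in>carrier G. \<chi> (inv x))"

lemma character_times_in_characters:
  "\<chi> \<in> characters G \<Longrightarrow> \<psi> \<in> characters G \<Longrightarrow> character_times \<chi> \<psi> \<in> characters G"
  by (auto simp: in_characters_iff partial_character_def character_times_def)

lemma character_inverse_in_characters:
  "\<chi> \<in> characters G \<Longrightarrow> character_inverse \<chi> \<in> characters G"
  by (auto simp: in_characters_iff partial_character_def character_inverse_def inv_mult)

lemma character_times_cancel:
  assumes "\<chi> \<in> characters G" "\<psi> \<in> characters G"
  shows "character_times \<psi> (character_times (character_inverse \<psi>) \<chi>) = \<chi>"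
    "character_times (character_inverse \<psi>) (character_times \<psi> \<chi>) = \<chi>"
  using assms character_inv[OF assms(2)]
  by (auto simp: character_times_def character_inverse_def fun_eq_iff in_characters_iff
      extensional_def algebra_simps simp flip: mult.assoc)

text \<open>
  The dual argument: multiplication by a character \<open>\<psi>\<close> with \<open>\<psi> g \<noteq> 1\<close> permutes the characters and
  multiplies the sum by \<open>\<psi> g\<close>.
\<close>

lemma sum_over_characters:
  assumes fin: "finite (carrier G)" and g: "g \<in> carrier G" "g \<noteq> \<one>"
  shows "(\<Sum>\<chi>\<in>characters G. \<chi> g) = 0"
proof -
  obtain \<psi> where \<psi>: "\<psi> \<in> characters G" "\<psi> g \<noteq> 1"
    using character_separates[OF fin g] by blast
  have "\<psi> g * (\<Sum>\<chi>\<in>characters G. \<chi> g) = (\<Sum>\<chi>\<in>characters G. character_times \<psi> \<chi> g)"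
    using g by (simp add: sum_distrib_left character_times_def)
  also have "\<dots> = (\<Sum>\<chi>\<in>characters G. \<chi> g)"
    by (rule sum.reindex_bij_witness[of _ "character_times (character_inverse \<psi>)" "character_times \<psi>"])
      (use \<psi>(1) in \<open>auto simp: character_times_cancel intro: character_times_in_characters
        character_inverse_in_characters\<close>)
  finally show ?thesis using \<psi>(2) by simp
qed

text \<open>
  Double counting of \<open>\<chi> g\<close> over all \<open>\<chi>\<close> and \<open>g\<close>: only \<open>g = \<one>\<close> contributes in one order of
  summation, only the trivial character in the other.
\<close>

lemma card_characters:
  assumes fin: "finite (carrier G)"
  shows "card (characters G) = order G"
proof -
  have "(\<Sum>\<chi>\<in>characters G. \<chi> \<one>) = (\<Sum>\<chi>\<in>characters G. 1)"
    by (intro sum.cong refl character_one)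
  then have "(of_nat (card (characters G)) :: complex) =
      (\<Sum>g\<in>{\<one>}. \<Sum>\<chi>\<in>characters G. \<chi> g)"
    by simp
  also have "\<dots> = (\<Sum>g\<in>carrier G. \<Sum>\<chi>\<in>characters G. \<chi> g)"
    by (rule sum.mono_neutral_left[OF fin]) (use sum_over_characters[OF fin] in auto)
  also have "\<dots> = (\<Sum>\<chi>\<in>characters G. \<Sum>g\<in>carrier G. \<chi> g)" by (rule sum.swap)
  also have "\<dots> = (\<Sum>\<chi>\<in>characters G. if \<chi> = trivial_character G then of_nat (order G) else 0)"
    by (intro sum.cong refl sum_character)
  also have "\<dots> = of_nat (order G)"
    by (simp add: finite_characters[OF fin] trivial_character_in_characters)
  finally show ?thesis by simp
qed

text \<open>
  The summand is a value of the quotient character \<open>\<psi> / \<chi>\<close>, which is trivial only for \<open>\<chi> = \<psi>\<close>.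
  Inverses in the group take the place of complex conjugates.
\<close>

lemma character_orthogonality:
  assumes \<chi>: "\<chi> \<in> characters G" and \<psi>: "\<psi> \<in> characters G"
  shows "(\<Sum>x\<in>carrier G. \<chi> (inv x) * \<psi> x) = (if \<chi> = \<psi> then of_nat (order G) else 0)"
proof -
  let ?\<phi> = "character_times (character_inverse \<chi>) \<psi>"
  have \<phi>: "?\<phi> \<in> characters G"
    using \<chi> \<psi> by (intro character_times_in_characters character_inverse_in_characters)
  have "character_times \<chi> (trivial_character G) = \<chi>"
    using \<chi> by (auto simp: character_times_def trivial_character_def fun_eq_iff in_characters_iff
        extensional_def)
  then have "\<chi> = \<psi>" if "?\<phi> = trivial_character G"
    using that character_times_cancel(1)[OF \<psi> \<chi>] by simp
  moreover have "?\<phi> = trivial_character G" if "\<chi> = \<psi>"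
    using character_inv[OF \<psi>] that
    by (auto simp: character_times_def character_inverse_def trivial_character_def fun_eq_iff)
  ultimately have "?\<phi> = trivial_character G \<longleftrightarrow> \<chi> = \<psi>" by blast
  then show ?thesis
    using sum_character[OF \<phi>] by (simp add: character_times_def character_inverse_def)
qed

end

section \<open>Diagonalisation of the group matrix by characters\<close>

lemma cpoly_const_simps:
  "cpoly_const 0 = 0" "cpoly_const 1 = 1"
  "cpoly_const (a + b) = cpoly_const a + cpoly_const b"
  "cpoly_const (a - b) = cpoly_const a - cpoly_const b"
  "cpoly_const (a * b) = cpoly_const a * cpoly_const b"
  by (simp_all add: cpoly_const_def single_add single_diff mult_single)

lemma cpoly_const_sum: "cpoly_const (\<Sum>x\<in>A. f x) = (\<Sum>x\<in>A. cpoly_const (f x))"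
  by (induction A rule: infinite_finite_induct) (simp_all add: cpoly_const_simps)

lemma cpoly_const_of_nat: "cpoly_const (of_nat n) = of_nat n"
  by (induction n) (simp_all add: cpoly_const_simps)

lemma cpoly_const_inverse:
  assumes "a \<noteq> 0"
  shows "cpoly_const (1 / a) * cpoly_const a = 1"
proof -
  have "1 / a * a = 1" using assms by simp
  then show ?thesis by (simp only: cpoly_const_simps(2) flip: cpoly_const_simps(5))
qed

context comm_group
begin

lemma group_matrix_row_sum:
  fixes x :: "'a \<Rightarrow> 'r::comm_ring_1"
  assumes "g \<in> carrier G"
  shows "(\<Sum>h\<in>carrier G. group_matrix G x (g, h) * f h) = (\<Sum>k\<in>carrier G. x k * f (g \<otimes> k))"
proof -
  have "(\<Sum>h\<in>carrier G. group_matrix G x (g, h) * f h) =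
      (\<Sum>k\<in>carrier G. group_matrix G x (g, g \<otimes> k) * f (g \<otimes> k))"
    by (rule sum_translate[OF assms, symmetric])
  also have "\<dots> = (\<Sum>k\<in>carrier G. x k * f (g \<otimes> k))"
    using assms by (intro sum.cong) (auto simp: group_matrix_def simp flip: m_assoc)
  finally show ?thesis .
qed

lemma group_matrix_column_sum:
  assumes "h \<in> carrier G"
  shows "(\<Sum>g\<in>carrier G. group_matrix G x (g, h)) = (\<Sum>k\<in>carrier G. x k)"
  using assms
  by (intro sum.reindex_bij_witness[of _ "\<lambda>k. h \<otimes> inv k" "\<lambda>g. inv g \<otimes> h"])
    (auto simp: group_matrix_def inv_mult m_ac)

definition character_eigenvalue :: "('a \<Rightarrow> 'v cpoly) \<Rightarrow> ('a \<Rightarrow> complex) \<Rightarrow> 'v cpoly" where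
  "character_eigenvalue x \<chi> = (\<Sum>g\<in>carrier G - {\<one>}. cpoly_const (1 - \<chi> g) * x g)"

text \<open>
  Row \<open>g\<close> of a group matrix is row \<open>\<one>\<close> translated by \<open>g\<close>, and translation by \<open>g\<close> multiplies a
  character \<open>\<chi>\<close> by \<open>\<chi> g\<close>; so characters are eigenvectors. The all-ones
  matrix annihilates every nontrivial character and has eigenvalue \<open>n\<close> at the trivial one, where
  the Laplacian has eigenvalue \<open>0\<close>.
\<close>

lemma laplacian_character_eigenvector:
  fixes x :: "'a \<Rightarrow> 'v cpoly"
  assumes fin: "finite (carrier G)" and \<chi>: "\<chi> \<in> characters G" and g: "g \<in> carrier G"
  shows "(\<Sum>h\<in>carrier G. (laplacian (carrier G) (group_matrix G x) g h + 1) * cpoly_const (\<chi> h)) =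
    cpoly_const (\<chi> g) *
      (if \<chi> = trivial_character G then of_nat (order G) else character_eigenvalue x \<chi>)"
proof -
  have eig: "character_eigenvalue x \<chi> = (\<Sum>k\<in>carrier G. x k) - (\<Sum>k\<in>carrier G. x k * cpoly_const (\<chi> k))"
  proof -
    have "character_eigenvalue x \<chi> = (\<Sum>k\<in>carrier G. cpoly_const (1 - \<chi> k) * x k)"
      unfolding character_eigenvalue_def
      by (rule sum.mono_neutral_left) (auto simp: fin character_one[OF \<chi>] cpoly_const_simps)
    then show ?thesis
      by (simp add: cpoly_const_simps algebra_simps sum_subtractf)
  qed
  have diag: "(\<Sum>h\<in>carrier G. group_matrix G x (g, h)) = (\<Sum>k\<in>carrier G. x k)"
    using group_matrix_row_sum[OF g, of x "\<lambda>_. 1"] by simp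
  have "(\<Sum>h\<in>carrier G. (laplacian (carrier G) (group_matrix G x) g h + 1) * cpoly_const (\<chi> h)) =
      (\<Sum>h\<in>carrier G. of_bool (h = g) * ((\<Sum>k\<in>carrier G. x k) * cpoly_const (\<chi> h))) -
      (\<Sum>h\<in>carrier G. group_matrix G x (g, h) * cpoly_const (\<chi> h)) +
      (\<Sum>h\<in>carrier G. cpoly_const (\<chi> h))"
    unfolding sum.distrib[symmetric] sum_subtractf[symmetric]
    by (intro sum.cong refl) (simp add: laplacian_def diag algebra_simps)
  also have "\<dots> = (\<Sum>k\<in>carrier G. x k) * cpoly_const (\<chi> g) -
      (\<Sum>k\<in>carrier G. x k * cpoly_const (\<chi> (g \<otimes> k))) + cpoly_const (\<Sum>h\<in>carrier G. \<chi> h)"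
    by (simp only: sum_of_bool_eq_mult[OF fin g] group_matrix_row_sum[OF g] cpoly_const_sum)
  also have "(\<Sum>k\<in>carrier G. x k * cpoly_const (\<chi> (g \<otimes> k))) =
      cpoly_const (\<chi> g) * (\<Sum>k\<in>carrier G. x k * cpoly_const (\<chi> k))"
    unfolding sum_distrib_left
    by (intro sum.cong refl) (simp add: character_mult[OF \<chi> g] cpoly_const_simps)
  also have "(\<Sum>k\<in>carrier G. x k) * cpoly_const (\<chi> g) -
      cpoly_const (\<chi> g) * (\<Sum>k\<in>carrier G. x k * cpoly_const (\<chi> k)) + cpoly_const (\<Sum>h\<in>carrier G. \<chi> h) =
      cpoly_const (\<chi> g) * character_eigenvalue x \<chi> + cpoly_const (\<Sum>h\<in>carrier G. \<chi> h)"
    by (simp add: eig algebra_simps)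
  also have "\<dots> = cpoly_const (\<chi> g) *
      (if \<chi> = trivial_character G then of_nat (order G) else character_eigenvalue x \<chi>)"
  proof (cases "\<chi> = trivial_character G")
    case True
    have "character_eigenvalue x \<chi> = 0"
      unfolding character_eigenvalue_def
      by (rule sum.neutral) (auto simp: True trivial_character_def cpoly_const_simps)
    moreover have "cpoly_const (\<chi> g) = (1 :: 'v cpoly)"
      using g by (simp add: True trivial_character_def cpoly_const_simps)
    ultimately show ?thesis
      using True sum_character[OF \<chi>] by (simp add: cpoly_const_of_nat)
  next
    case False
    then show ?thesis by (simp add: sum_character[OF \<chi>] cpoly_const_simps)
  qed
  finally show ?thesis .
qed

text \<open>
  As there are \<open>n\<close> characters, they can be numbered by the group elements themselves, by a bijection
  \<open>c\<close>, and then form the columns of a square matrix \<open>F\<close>. Orthogonality gives \<open>det F' det F = n\<^sup>n\<close>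
  for the matrix \<open>F'\<close> of inverse values. This constant is invertible, so multiplication by
  \<open>det F'\<close> cancels \<open>det F\<close> from \<open>det M det F = det F \<Prod>\<mu>\<close>.
\<close>

lemma det_laplacian_plus_ones_characters:
  fixes x :: "'a \<Rightarrow> 'v cpoly"
  assumes fin: "finite (carrier G)"
  shows "det_on (carrier G) (\<lambda>g h. laplacian (carrier G) (group_matrix G x) g h + 1) =
    of_nat (order G) * (\<Prod>\<chi>\<in>characters G - {trivial_character G}. character_eigenvalue x \<chi>)"
proof -
  let ?V = "carrier G"
  let ?M = "\<lambda>g h. laplacian ?V (group_matrix G x) g h + 1"
  define \<mu> where
    "\<mu> \<chi> = (if \<chi> = trivial_character G then of_nat (order G) else character_eigenvalue x \<chi>)" for \<chi>
  have "card ?V = card (characters G)" using card_characters[OF fin] by (simp add: order_def)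
  then obtain c where c: "bij_betw c ?V (characters G)"
    using finite_same_card_bij[OF fin finite_characters[OF fin]] by blast
  have c_in: "c i \<in> characters G" if "i \<in> ?V" for i using c that by (auto simp: bij_betw_def)
  define F :: "'a \<Rightarrow> 'a \<Rightarrow> 'v cpoly" where "F = (\<lambda>g i. cpoly_const (c i g))"
  define F' :: "'a \<Rightarrow> 'a \<Rightarrow> 'v cpoly" where "F' = (\<lambda>i g. cpoly_const (c i (inv g)))"
  let ?N = "of_nat (order G) ^ card ?V :: complex"
  have "det_on ?V ?M * det_on ?V F = det_on ?V (\<lambda>g i. \<Sum>h\<in>?V. ?M g h * F h i)"
    by (rule det_on_mult[OF fin, symmetric])
  also have "\<dots> = det_on ?V (\<lambda>g i. \<Sum>j\<in>?V. F g j * (if j = i then \<mu> (c j) else 0))"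
  proof (rule det_on_cong)
    fix g i assume g: "g \<in> ?V" and i: "i \<in> ?V"
    have "(\<Sum>h\<in>?V. ?M g h * F h i) = F g i * \<mu> (c i)"
      unfolding F_def \<mu>_def by (rule laplacian_character_eigenvector[OF fin c_in[OF i] g])
    also have "\<dots> = (\<Sum>j\<in>?V. if j = i then F g i * \<mu> (c i) else 0)"
      using fin i by simp
    also have "\<dots> = (\<Sum>j\<in>?V. F g j * (if j = i then \<mu> (c j) else 0))"
      by (intro sum.cong) auto
    finally show "(\<Sum>h\<in>?V. ?M g h * F h i) = (\<Sum>j\<in>?V. F g j * (if j = i then \<mu> (c j) else 0))" .
  qed
  also have "\<dots> = det_on ?V F * (\<Prod>i\<in>?V. \<mu> (c i))"
    unfolding det_on_mult[OF fin] det_on_diagonal[OF fin] ..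
  finally have MF: "det_on ?V ?M * det_on ?V F = det_on ?V F * (\<Prod>i\<in>?V. \<mu> (c i))" .
  have "det_on ?V F' * det_on ?V F = det_on ?V (\<lambda>i j. \<Sum>g\<in>?V. F' i g * F g j)"
    by (rule det_on_mult[OF fin, symmetric])
  also have "\<dots> = det_on ?V (\<lambda>i j. if i = j then of_nat (order G) else 0)"
  proof (rule det_on_cong)
    fix i j assume ij: "i \<in> ?V" "j \<in> ?V"
    have "(\<Sum>g\<in>?V. F' i g * F g j) = cpoly_const (\<Sum>g\<in>?V. c i (inv g) * c j g)"
      by (simp add: F_def F'_def cpoly_const_sum cpoly_const_simps)
    also have "\<dots> = (if i = j then of_nat (order G) else 0)"
      using inj_on_eq_iff[OF bij_betw_imp_inj_on[OF c] ij]
      by (simp add: character_orthogonality[OF c_in[OF ij(1)] c_in[OF ij(2)]] cpoly_const_simps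
          cpoly_const_of_nat)
    finally show "(\<Sum>g\<in>?V. F' i g * F g j) = (if i = j then of_nat (order G) else 0)" .
  qed
  also have "\<dots> = cpoly_const ?N"
    by (simp add: det_on_diagonal[OF fin] cpoly_const_of_nat flip: of_nat_power)
  finally have FF: "det_on ?V F' * det_on ?V F = cpoly_const ?N" .
  have "?N \<noteq> 0" using fin by (simp add: order_gt_0_iff_finite)
  then have inv_N: "cpoly_const (1 / ?N) * cpoly_const ?N = (1 :: 'v cpoly)"
    by (rule cpoly_const_inverse)
  have "det_on ?V ?M = cpoly_const (1 / ?N) * (det_on ?V F' * det_on ?V F) * det_on ?V ?M"
    by (simp only: FF inv_N mult_1)
  also have "\<dots> = cpoly_const (1 / ?N) * det_on ?V F' * (det_on ?V ?M * det_on ?V F)"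
    by (simp only: ac_simps)
  also have "\<dots> = cpoly_const (1 / ?N) * (det_on ?V F' * det_on ?V F) * (\<Prod>i\<in>?V. \<mu> (c i))"
    unfolding MF by (simp only: ac_simps)
  also have "\<dots> = (\<Prod>i\<in>?V. \<mu> (c i))"
    by (simp only: FF inv_N mult_1)
  also have "\<dots> = (\<Prod>\<chi>\<in>characters G. \<mu> \<chi>)" by (rule prod.reindex_bij_betw[OF c])
  also have "\<dots> = \<mu> (trivial_character G) * (\<Prod>\<chi>\<in>characters G - {trivial_character G}. \<mu> \<chi>)"
    by (rule prod.remove[OF finite_characters[OF fin] trivial_character_in_characters])
  finally show ?thesis by (simp add: \<mu>_def)
qed

text \<open>
  The determinant of the Laplacian plus the all-ones matrix is \<open>n\<^sup>2\<close> times the weighted complexity,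
  because row and column sums of a group matrix all equal the sum of the variables, and it is also the
  product of the eigenvalues, among which the trivial character contributes \<open>n\<close>.
\<close>

theorem weighted_complexity_group_matrix:
  fixes x :: "'a \<Rightarrow> 'v cpoly"
  assumes fin: "finite (carrier G)" and v: "v \<in> carrier G"
  shows "weighted_complexity (complete_loop_graph G) (group_matrix G x) v =
    cpoly_const (1 / of_nat (order G)) *
    (\<Prod>\<chi>\<in>characters G - {trivial_character G}. character_eigenvalue x \<chi>)"
proof -
  let ?V = "carrier G" and ?n = "of_nat (order G) :: 'v cpoly"
  let ?\<kappa> = "weighted_complexity (complete_loop_graph G) (group_matrix G x) v"
  let ?P = "\<Prod>\<chi>\<in>characters G - {trivial_character G}. character_eigenvalue x \<chi>"
  have \<kappa>: "?\<kappa> = det_on ?V (reduced_laplacian ?V (group_matrix G x) v)"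
    unfolding complete_loop_graph_def by (rule weighted_matrix_tree[OF fin v])
  have balanced: "(\<Sum>g\<in>?V. group_matrix G x (g, h)) = (\<Sum>k\<in>?V. group_matrix G x (h, k))"
    if "h \<in> ?V" for h
    using group_matrix_row_sum[OF that, of x "\<lambda>_. 1"] group_matrix_column_sum[OF that, of x] by simp
  have eq: "?n ^ 2 * ?\<kappa> = ?n * ?P"
  proof -
    have "det_on ?V (\<lambda>g h. laplacian ?V (group_matrix G x) g h + 1) = ?n ^ 2 * ?\<kappa>"
      unfolding \<kappa> order_def by (rule det_laplacian_plus_ones[OF fin v balanced])
    then show ?thesis
      unfolding det_laplacian_plus_ones_characters[OF fin] by (rule sym)
  qed
  define r :: "'v cpoly" where "r = cpoly_const (1 / of_nat (order G))"
  have "order G \<noteq> 0" using fin by (simp add: order_gt_0_iff_finite)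
  then have r: "r * ?n = 1"
    unfolding r_def cpoly_const_of_nat[symmetric] by (intro cpoly_const_inverse) simp
  have "?\<kappa> = (r * ?n) * (r * ?n) * ?\<kappa>" by (simp add: r)
  also have "\<dots> = r * r * (?n ^ 2 * ?\<kappa>)" by (simp add: power2_eq_square ac_simps)
  also have "\<dots> = r * (r * ?n) * ?P" unfolding eq by (simp add: ac_simps)
  also have "\<dots> = r * ?P" by (simp add: r)
  finally show ?thesis by (simp only: r_def)
qed

end

theorem theorem12:
  fixes \<Gamma> :: "('a, 'm) monoid_scheme"
    and x :: "'a \<Rightarrow> 'v cpoly"
    and v :: 'a
  assumes "comm_group \<Gamma>" and "finite (carrier \<Gamma>)"
    and var: "\<And>g. g \<in> carrier \<Gamma> \<Longrightarrow> g \<noteq> \<one>\<^bsub>\<Gamma>\<^esub> \<Longrightarrow> x g \<in> range cpoly_var"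
    and indep: "\<And>g h. g \<in> carrier \<Gamma> \<Longrightarrow> h \<in> carrier \<Gamma> \<Longrightarrow> g \<noteq> \<one>\<^bsub>\<Gamma>\<^esub> \<Longrightarrow> h \<noteq> \<one>\<^bsub>\<Gamma>\<^esub> \<Longrightarrow>
           x g = x h \<Longrightarrow> h = g \<or> h = inv\<^bsub>\<Gamma>\<^esub> g"
    and sym: "\<And>g. g \<in> carrier \<Gamma> \<Longrightarrow> g \<noteq> \<one>\<^bsub>\<Gamma>\<^esub> \<Longrightarrow> x g = x (inv\<^bsub>\<Gamma>\<^esub> g)"
    and one: "x \<one>\<^bsub>\<Gamma>\<^esub> = 0"
    and root: "v \<in> carrier \<Gamma>"
  shows "weighted_complexity (complete_loop_graph \<Gamma>) (group_matrix \<Gamma> x) v =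
           cpoly_const (1 / of_nat (order \<Gamma>)) *
           (\<Prod>\<chi> \<in> characters \<Gamma> - {trivial_character \<Gamma>}.
              \<Sum>g \<in> carrier \<Gamma> - {\<one>\<^bsub>\<Gamma>\<^esub>}. cpoly_const (1 - \<chi> g) * x g)"
  using comm_group.weighted_complexity_group_matrix[OF assms(1,2) root, of x]
  unfolding comm_group.character_eigenvalue_def[OF assms(1)] .

end
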